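(* Let $S$ be a $T$--signature. Then the category $\mathrm{Rep}(S)$ of representations of $S$ has an initial object $\Sigma(S)$.
   Context: Fix a set $T$ of object types and let $[T,\mathrm{Set}]$ be the category of $T$-indexed families of sets, with morphisms $f:V\to W$ the families of maps $f_t:V_t\to W_t$. A monad $P$ on a category $\mathcal{C}$ is given (as a Kleisli triple) by an object map $P$, morphisms $\eta_c : c\to Pc$ and a substitution $\sigma : \mathcal{C}(c,Pd)\to\mathcal{C}(Pc,Pd)$ satisfying the usual three laws; a morphism of monads $\tau:P\to Q$ is a family $\tau_c : Pc\to Qc$ commuting with $\eta$ and with substitution. A module $M$ over $P$ with codomain $\mathcal{D}$ is an object map $M:\mathcal{C}\to\mathcal{D}$ with a substitution $\varsigma:\mathcal{C}(c,Pd)\to\mathcal{D}(Mc,Md)$ compatible with $\eta$ and $\sigma$; module morphisms are families commuting with module substitution. Every monad $P$ is a module over itself; for a $Q$-module $M$ and monad morphism $h:P\to Q$, the pullback $h^*M$ is the $P$-module with the same object map and substitution $f\mapsto \varsigma^M(f;h_d)$, and $h$ induces a $P$-module morphism $P\to h^*Q$. For a $P$-module $M$ with codomain $[T,\mathrm{Set}]$ and $u\in T$, the fibre $M_u$ is the $P$-module with codomain $\mathrm{Set}$ given by $V\mapsto (MV)(u)$, and the derived module $M^u$ is $V\mapsto M(V+D(u))$ where $D(u)$ contains one fresh variable of type $u$ (iterating along a list $\vec{s}$ of types gives $M^{\vec{s}}$); products of modules are taken componentwise. A $T$--arity is $\alpha = (\vec{s}_1)t_1,\ldots,(\vec{s}_n)t_n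 \to t_0$ with $t_i\in T$ and $\vec{s}_i$ lists of elements of $T$ (the variables bound in the $i$-th argument); a $T$--signature is a family of $T$--arities. A representation of $\alpha$ in a monad $R$ on $[T,\mathrm{Set}]$ is an $R$-module morphism $(R^{\vec{s}_1})_{t_1}\times\cdots\times(R^{\vec{s}_n})_{t_n}\to R_{t_0}$. A representation of a signature $S$ is a monad $P$ on $[T,\mathrm{Set}]$ together with a representation of each arity of $S$ in $P$. A morphism of representations $P\to Q$ of $S$ is a monad morphism $f:P\to Q$ such that for every arity $\alpha$ of $S$ the square of $P$-modules commutes: $\alpha^P ; f_{t_0} = \prod_i (f^{\vec{s}_i})_{t_i} ; f^*(\alpha^Q)$ (up to the canonical isomorphisms expressing that pullback commutes with products, derivation and fibres). These form the category $\mathrm{Rep}(S)$. An initial object is an object with exactly one morphism to every object. *)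

theory Defs
  imports "HOL-Library.FuncSet" "HOL-Library.Equipollence"
begin

section \<open>Categories\<close>

text \<open>
  Hom-sets need not be disjoint, so identities and composition carry their objects explicitly.
  Composition is diagrammatic: \<open>Comp C a b c f g\<close> is \<open>f; g\<close> for \<open>f : a \<rightarrow> b\<close> and \<open>g : b \<rightarrow> c\<close>.
\<close>

record ('o, 'm) cat =
  Obj :: "'o set"
  Hom :: "'o \<Rightarrow> 'o \<Rightarrow> 'm set"
  Ident :: "'o \<Rightarrow> 'm"
  Comp :: "'o \<Rightarrow> 'o \<Rightarrow> 'o \<Rightarrow> 'm \<Rightarrow> 'm \<Rightarrow> 'm"

locale category =
  fixes C :: "('o, 'm) cat"
  assumes Ident_in: "a \<in> Obj C \<Longrightarrow> Ident C a \<in> Hom C a a"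
    and Comp_in: "\<lbrakk>a \<in> Obj C; b \<in> Obj C; c \<in> Obj C; f \<in> Hom C a b; g \<in> Hom C b c\<rbrakk>
      \<Longrightarrow> Comp C a b c f g \<in> Hom C a c"
    and Ident_left: "\<lbrakk>a \<in> Obj C; b \<in> Obj C; f \<in> Hom C a b\<rbrakk> \<Longrightarrow> Comp C a a b (Ident C a) f = f"
    and Ident_right: "\<lbrakk>a \<in> Obj C; b \<in> Obj C; f \<in> Hom C a b\<rbrakk> \<Longrightarrow> Comp C a b b f (Ident C b) = f"
    and Comp_assoc: "\<lbrakk>a \<in> Obj C; b \<in> Obj C; c \<in> Obj C; d \<in> Obj C;
        f \<in> Hom C a b; g \<in> Hom C b c; h \<in> Hom C c d\<rbrakk>
      \<Longrightarrow> Comp C a c d (Comp C a b c f g) h = Comp C a b d f (Comp C b c d g h)"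

definition initial_object :: "('o, 'm) cat \<Rightarrow> 'o \<Rightarrow> bool" where
  "initial_object C a \<longleftrightarrow> a \<in> Obj C \<and> (\<forall>b\<in>Obj C. \<exists>!f. f \<in> Hom C a b)"

section \<open>The category of sets, and families of sets\<close>

text \<open>
  HOL has no type of all sets, so the category of sets is taken relative to a universe: a collection
  \<open>U\<close> of subsets of a type, closed under subsets, replacement and small unions and containing an
  infinite set. Every Grothendieck universe with an infinite member gives an example, and so does
  the collection of all subsets of any infinite type (see \<open>set_universe_UNIV\<close> below). Closure under
  power sets is not demanded.
\<close>

definition set_universe :: "'u set set \<Rightarrow> bool" where
  "set_universe U \<longleftrightarrow>
     (\<forall>A\<in>U. \<forall>B. B \<subseteq> A \<longrightarrow> B \<in> U) \<and>
     (\<forall>A\<in>U. \<forall>f. f ` A \<in> U) \<and>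
     (\<forall>A\<in>U. \<forall>F. (\<forall>a\<in>A. F a \<in> U) \<longrightarrow> (\<Union>a\<in>A. F a) \<in> U) \<and>
     (\<exists>A\<in>U. infinite A)"

text \<open>A set of any type is small if it is in bijection with a member of the universe.\<close>

definition small :: "'u set set \<Rightarrow> 'x set \<Rightarrow> bool" where
  "small U A \<longleftrightarrow> (\<exists>B\<in>U. A \<approx> B)"

text \<open>Maps are extensional functions, so equality in a hom-set is equality of maps.\<close>

definition Set_cat :: "'u set set \<Rightarrow> ('u set, 'u \<Rightarrow> 'u) cat" where
  "Set_cat U = \<lparr>Obj = U,
                Hom = (\<lambda>A B. A \<rightarrow>\<^sub>E B),
                Ident = (\<lambda>A. \<lambda>x\<in>A. x),
                Comp = (\<lambda>A B D f g. compose A g f)\<rparr>"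

definition Fam_cat :: "'t set \<Rightarrow> ('o, 'm) cat \<Rightarrow> ('t \<Rightarrow> 'o, 't \<Rightarrow> 'm) cat" where
  "Fam_cat T D = \<lparr>Obj = T \<rightarrow>\<^sub>E Obj D,
                  Hom = (\<lambda>V W. \<Pi>\<^sub>E t\<in>T. Hom D (V t) (W t)),
                  Ident = (\<lambda>V. \<lambda>t\<in>T. Ident D (V t)),
                  Comp = (\<lambda>V W X f g. \<lambda>t\<in>T. Comp D (V t) (W t) (X t) (f t) (g t))\<rparr>"

type_synonym ('t, 'u) fam = "'t \<Rightarrow> 'u set"
type_synonym ('t, 'u) fam_map = "'t \<Rightarrow> 'u \<Rightarrow> 'u"

abbreviation TSet :: "'u set set \<Rightarrow> 't set \<Rightarrow> (('t, 'u) fam, ('t, 'u) fam_map) cat" where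
  "TSet U T \<equiv> Fam_cat T (Set_cat U)"

section \<open>Monads and modules\<close>

text \<open>
  The components of monads and modules are relevant only on objects and morphisms of the base
  category; their values elsewhere are left unconstrained. Families that are \<^emph>\<open>morphisms\<close> are
  extensional, so that equality of morphisms is componentwise equality.
\<close>

record ('o, 'm) kmonad =
  ob :: "'o \<Rightarrow> 'o"
  unit :: "'o \<Rightarrow> 'm"
  subst :: "'o \<Rightarrow> 'o \<Rightarrow> 'm \<Rightarrow> 'm"

definition is_monad :: "('o, 'm) cat \<Rightarrow> ('o, 'm, 'z) kmonad_scheme \<Rightarrow> bool" where
  "is_monad C P \<longleftrightarrow>
     (\<forall>c\<in>Obj C. ob P c \<in> Obj C) \<and>
     (\<forall>c\<in>Obj C. unit P c \<in> Hom C c (ob P c)) \<and>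
     (\<forall>c\<in>Obj C. \<forall>d\<in>Obj C. \<forall>f\<in>Hom C c (ob P d). subst P c d f \<in> Hom C (ob P c) (ob P d)) \<and>
     (\<forall>c\<in>Obj C. \<forall>d\<in>Obj C. \<forall>f\<in>Hom C c (ob P d).
        Comp C c (ob P c) (ob P d) (unit P c) (subst P c d f) = f) \<and>
     (\<forall>c\<in>Obj C. subst P c c (unit P c) = Ident C (ob P c)) \<and>
     (\<forall>c\<in>Obj C. \<forall>d\<in>Obj C. \<forall>e\<in>Obj C. \<forall>f\<in>Hom C c (ob P d). \<forall>g\<in>Hom C d (ob P e).
        Comp C (ob P c) (ob P d) (ob P e) (subst P c d f) (subst P d e g) =
        subst P c e (Comp C c (ob P d) (ob P e) f (subst P d e g)))"

definition monad_hom ::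
    "('o, 'm) cat \<Rightarrow> ('o, 'm, 'y) kmonad_scheme \<Rightarrow> ('o, 'm, 'z) kmonad_scheme \<Rightarrow> ('o \<Rightarrow> 'm) set" where
  "monad_hom C P Q = {\<tau> \<in> (\<Pi>\<^sub>E c\<in>Obj C. Hom C (ob P c) (ob Q c)).
     (\<forall>c\<in>Obj C. Comp C c (ob P c) (ob Q c) (unit P c) (\<tau> c) = unit Q c) \<and>
     (\<forall>c\<in>Obj C. \<forall>d\<in>Obj C. \<forall>f\<in>Hom C c (ob P d).
        Comp C (ob P c) (ob P d) (ob Q d) (subst P c d f) (\<tau> d) =
        Comp C (ob P c) (ob Q c) (ob Q d) (\<tau> c)
          (subst Q c d (Comp C c (ob P d) (ob Q d) f (\<tau> d))))}"

record ('o, 'm, 'd, 'n) kmodule =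
  mob :: "'o \<Rightarrow> 'd"
  msubst :: "'o \<Rightarrow> 'o \<Rightarrow> 'm \<Rightarrow> 'n"

definition is_module ::
    "('o, 'm) cat \<Rightarrow> ('o, 'm, 'z) kmonad_scheme \<Rightarrow> ('d, 'n) cat \<Rightarrow> ('o, 'm, 'd, 'n) kmodule \<Rightarrow> bool" where
  "is_module C P D M \<longleftrightarrow>
     (\<forall>c\<in>Obj C. mob M c \<in> Obj D) \<and>
     (\<forall>c\<in>Obj C. \<forall>d\<in>Obj C. \<forall>f\<in>Hom C c (ob P d). msubst M c d f \<in> Hom D (mob M c) (mob M d)) \<and>
     (\<forall>c\<in>Obj C. msubst M c c (unit P c) = Ident D (mob M c)) \<and>
     (\<forall>c\<in>Obj C. \<forall>d\<in>Obj C. \<forall>e\<in>Obj C. \<forall>f\<in>Hom C c (ob P d). \<forall>g\<in>Hom C d (ob P e).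
        Comp D (mob M c) (mob M d) (mob M e) (msubst M c d f) (msubst M d e g) =
        msubst M c e (Comp C c (ob P d) (ob P e) f (subst P d e g)))"

definition module_hom ::
    "('o, 'm) cat \<Rightarrow> ('o, 'm, 'z) kmonad_scheme \<Rightarrow> ('d, 'n) cat \<Rightarrow>
     ('o, 'm, 'd, 'n) kmodule \<Rightarrow> ('o, 'm, 'd, 'n) kmodule \<Rightarrow> ('o \<Rightarrow> 'n) set" where
  "module_hom C P D M N = {\<rho> \<in> (\<Pi>\<^sub>E c\<in>Obj C. Hom D (mob M c) (mob N c)).
     \<forall>c\<in>Obj C. \<forall>d\<in>Obj C. \<forall>f\<in>Hom C c (ob P d).
        Comp D (mob M c) (mob M d) (mob N d) (msubst M c d f) (\<rho> d) =
        Comp D (mob M c) (mob N c) (mob N d) (\<rho> c) (msubst N c d f)}"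

definition tautological :: "('o, 'm, 'z) kmonad_scheme \<Rightarrow> ('o, 'm, 'o, 'm) kmodule" where
  "tautological P = \<lparr>mob = ob P, msubst = subst P\<rparr>"

definition pullback ::
    "('o, 'm) cat \<Rightarrow> ('o, 'm, 'y) kmonad_scheme \<Rightarrow> ('o, 'm, 'z) kmonad_scheme \<Rightarrow> ('o \<Rightarrow> 'm) \<Rightarrow>
     ('o, 'm, 'd, 'n) kmodule \<Rightarrow> ('o, 'm, 'd, 'n) kmodule" where
  "pullback C P Q h M = \<lparr>mob = mob M,
     msubst = (\<lambda>c d f. msubst M c d (Comp C c (ob P d) (ob Q d) f (h d)))\<rparr>"

text \<open>Composition of families of morphisms with components \<open>\<rho> c : A c \<rightarrow> B c\<close> and \<open>\<tau> c : B c \<rightarrow> E c\<close>.\<close>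

definition comp_fam ::
    "('o, 'm) cat \<Rightarrow> ('d, 'n) cat \<Rightarrow> ('o \<Rightarrow> 'd) \<Rightarrow> ('o \<Rightarrow> 'd) \<Rightarrow> ('o \<Rightarrow> 'd) \<Rightarrow>
     ('o \<Rightarrow> 'n) \<Rightarrow> ('o \<Rightarrow> 'n) \<Rightarrow> ('o \<Rightarrow> 'n)" where
  "comp_fam C D A B E \<rho> \<tau> = (\<lambda>c\<in>Obj C. Comp D (A c) (B c) (E c) (\<rho> c) (\<tau> c))"

section \<open>Fibres, derivation and products\<close>

definition fibre :: "'t \<Rightarrow> ('o, 'm, 't \<Rightarrow> 'd, 't \<Rightarrow> 'n) kmodule \<Rightarrow> ('o, 'm, 'd, 'n) kmodule" where
  "fibre u M = \<lparr>mob = (\<lambda>V. mob M V u), msubst = (\<lambda>V W f. msubst M V W f u)\<rparr>"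

definition fibre_mor :: "('o, 'm) cat \<Rightarrow> 't \<Rightarrow> ('o \<Rightarrow> 't \<Rightarrow> 'n) \<Rightarrow> ('o \<Rightarrow> 'n)" where
  "fibre_mor C u \<rho> = (\<lambda>V\<in>Obj C. \<rho> V u)"

text \<open>
  The coproduct \<open>V + D(u)\<close> has to live in the same type as \<open>V\<close>. It is coded by a fixed
  injection of \<open>'u option\<close> into the (infinite) type \<open>'u\<close>, with \<open>None\<close> as the fresh variable.
\<close>

definition var_code :: "'u option \<Rightarrow> 'u" where
  "var_code = (SOME e. inj e)"

definition ext :: "'t set \<Rightarrow> 't \<Rightarrow> ('t, 'u) fam \<Rightarrow> ('t, 'u) fam" where
  "ext T u V = (\<lambda>t\<in>T. var_code ` (Some ` V t \<union> (if t = u then {None} else {})))"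

definition old :: "'t set \<Rightarrow> ('t, 'u) fam \<Rightarrow> ('t, 'u) fam_map" where
  "old T V = (\<lambda>t\<in>T. \<lambda>x\<in>V t. var_code (Some x))"

text \<open>The copairing \<open>V + D(u) \<rightarrow> W\<close> of \<open>f : V \<rightarrow> W\<close> with the map \<open>D(u) \<rightarrow> W\<close> picking \<open>y \<in> W u\<close>.\<close>

definition copair :: "'t set \<Rightarrow> 't \<Rightarrow> ('t, 'u) fam \<Rightarrow> ('t, 'u) fam_map \<Rightarrow> 'u \<Rightarrow> ('t, 'u) fam_map" where
  "copair T u V f y =
     (\<lambda>t\<in>T. \<lambda>z\<in>ext T u V t. case inv var_code z of Some x \<Rightarrow> f t x | None \<Rightarrow> y)"

definition lift ::
    "('o, 'm) cat \<Rightarrow> ('o, 'm, 'z) kmonad_scheme \<Rightarrow> 'o \<Rightarrow> 'o \<Rightarrow> 'm \<Rightarrow> 'm" where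
  "lift C P c d f = subst P c d (Comp C c d (ob P d) f (unit P d))"

text \<open>Extension of \<open>f : V \<rightarrow> P W\<close> to \<open>V + D(u) \<rightarrow> P (W + D(u))\<close>, fixing the fresh variable.\<close>

definition shift ::
    "'u set set \<Rightarrow> 't set \<Rightarrow> (('t, 'u) fam, ('t, 'u) fam_map, 'z) kmonad_scheme \<Rightarrow> 't \<Rightarrow>
     ('t, 'u) fam \<Rightarrow> ('t, 'u) fam \<Rightarrow> ('t, 'u) fam_map \<Rightarrow> ('t, 'u) fam_map" where
  "shift U T P u V W f =
     copair T u V
       (Comp (TSet U T) V (ob P W) (ob P (ext T u W)) f (lift (TSet U T) P W (ext T u W) (old T W)))
       (unit P (ext T u W) u (var_code None))"

definition derived ::
    "'u set set \<Rightarrow> 't set \<Rightarrow> (('t, 'u) fam, ('t, 'u) fam_map, 'z) kmonad_scheme \<Rightarrow> 't \<Rightarrow>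
     (('t, 'u) fam, ('t, 'u) fam_map, 'd, 'n) kmodule \<Rightarrow>
     (('t, 'u) fam, ('t, 'u) fam_map, 'd, 'n) kmodule" where
  "derived U T P u M = \<lparr>mob = (\<lambda>V. mob M (ext T u V)),
     msubst = (\<lambda>V W f. msubst M (ext T u V) (ext T u W) (shift U T P u V W f))\<rparr>"

definition derived_mor ::
    "'u set set \<Rightarrow> 't set \<Rightarrow> 't \<Rightarrow> (('t, 'u) fam \<Rightarrow> 'n) \<Rightarrow> (('t, 'u) fam \<Rightarrow> 'n)" where
  "derived_mor U T u \<rho> = (\<lambda>V\<in>Obj (TSet U T). \<rho> (ext T u V))"

definition derived_list ::
    "'u set set \<Rightarrow> 't set \<Rightarrow> (('t, 'u) fam, ('t, 'u) fam_map, 'z) kmonad_scheme \<Rightarrow> 't list \<Rightarrow>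
     (('t, 'u) fam, ('t, 'u) fam_map, 'd, 'n) kmodule \<Rightarrow>
     (('t, 'u) fam, ('t, 'u) fam_map, 'd, 'n) kmodule" where
  "derived_list U T P ss M = fold (derived U T P) ss M"

definition derived_list_mor ::
    "'u set set \<Rightarrow> 't set \<Rightarrow> 't list \<Rightarrow> (('t, 'u) fam \<Rightarrow> 'n) \<Rightarrow> (('t, 'u) fam \<Rightarrow> 'n)" where
  "derived_list_mor U T ss \<rho> = fold (derived_mor U T) ss \<rho>"

text \<open>
  The product of the sets \<open>A\<^sub>1, \<dots>, A\<^sub>n\<close> consists of the lists in \<open>listset [A\<^sub>1, \<dots>, A\<^sub>n]\<close>, coded in the
  type \<open>'u\<close> by a fixed injection. The empty product is the one-element set \<open>{list_code []}\<close>.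
\<close>

definition list_code :: "'u list \<Rightarrow> 'u" where
  "list_code = (SOME e. inj e)"

definition prod_set :: "'u set list \<Rightarrow> 'u set" where
  "prod_set As = list_code ` listset As"

definition prod_map :: "'u set list \<Rightarrow> ('u \<Rightarrow> 'u) list \<Rightarrow> 'u \<Rightarrow> 'u" where
  "prod_map As fs = (\<lambda>z\<in>prod_set As. list_code (map2 (\<lambda>f x. f x) fs (inv list_code z)))"

definition prod_module ::
    "('o, 'm, 'u set, 'u \<Rightarrow> 'u) kmodule list \<Rightarrow> ('o, 'm, 'u set, 'u \<Rightarrow> 'u) kmodule" where
  "prod_module Ms = \<lparr>mob = (\<lambda>V. prod_set (map (\<lambda>M. mob M V) Ms)),
     msubst = (\<lambda>V W f. prod_map (map (\<lambda>M. mob M V) Ms) (map (\<lambda>M. msubst M V W f) Ms))\<rparr>"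

definition prod_mor ::
    "('o, 'm) cat \<Rightarrow> ('o, 'm, 'u set, 'u \<Rightarrow> 'u) kmodule list \<Rightarrow> ('o \<Rightarrow> 'u \<Rightarrow> 'u) list \<Rightarrow>
     ('o \<Rightarrow> 'u \<Rightarrow> 'u)" where
  "prod_mor C Ms \<rho>s = (\<lambda>V\<in>Obj C. prod_map (map (\<lambda>M. mob M V) Ms) (map (\<lambda>\<rho>. \<rho> V) \<rho>s))"

section \<open>Signatures and representations\<close>

text \<open>The pair \<open>([(s\<^sub>1, t\<^sub>1), \<dots>, (s\<^sub>n, t\<^sub>n)], t\<^sub>0)\<close> stands for the arity \<open>(s\<^sub>1)t\<^sub>1, \<dots>, (s\<^sub>n)t\<^sub>n \<rightarrow> t\<^sub>0\<close>.\<close>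

type_synonym 't arity = "('t list \<times> 't) list \<times> 't"

definition is_arity :: "'t set \<Rightarrow> 't arity \<Rightarrow> bool" where
  "is_arity T \<alpha> \<longleftrightarrow> \<alpha> \<in> lists (lists T \<times> T) \<times> T"

definition arity_args ::
    "'u set set \<Rightarrow> 't set \<Rightarrow> (('t, 'u) fam, ('t, 'u) fam_map, 'z) kmonad_scheme \<Rightarrow> 't arity \<Rightarrow>
     (('t, 'u) fam, ('t, 'u) fam_map, 'u set, 'u \<Rightarrow> 'u) kmodule list" where
  "arity_args U T R \<alpha> = map (\<lambda>(ss, t). fibre t (derived_list U T R ss (tautological R))) (fst \<alpha>)"

definition arity_dom ::
    "'u set set \<Rightarrow> 't set \<Rightarrow> (('t, 'u) fam, ('t, 'u) fam_map, 'z) kmonad_scheme \<Rightarrow> 't arity \<Rightarrow>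
     (('t, 'u) fam, ('t, 'u) fam_map, 'u set, 'u \<Rightarrow> 'u) kmodule" where
  "arity_dom U T R \<alpha> = prod_module (arity_args U T R \<alpha>)"

definition arity_cod ::
    "(('t, 'u) fam, ('t, 'u) fam_map, 'z) kmonad_scheme \<Rightarrow> 't arity \<Rightarrow>
     (('t, 'u) fam, ('t, 'u) fam_map, 'u set, 'u \<Rightarrow> 'u) kmodule" where
  "arity_cod R \<alpha> = fibre (snd \<alpha>) (tautological R)"

definition arity_mor ::
    "'u set set \<Rightarrow> 't set \<Rightarrow> (('t, 'u) fam, ('t, 'u) fam_map, 'z) kmonad_scheme \<Rightarrow> 't arity \<Rightarrow>
     (('t, 'u) fam \<Rightarrow> ('t, 'u) fam_map) \<Rightarrow> (('t, 'u) fam \<Rightarrow> 'u \<Rightarrow> 'u)" where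
  "arity_mor U T P \<alpha> f = prod_mor (TSet U T) (arity_args U T P \<alpha>)
     (map (\<lambda>(ss, t). fibre_mor (TSet U T) t (derived_list_mor U T ss f)) (fst \<alpha>))"

text \<open>
  A signature assigns an arity \<open>S i\<close> to each element of a set \<open>I\<close>; like every set in sight, \<open>T\<close> and \<open>I\<close>
  have to belong (up to bijection) to the universe.
\<close>

definition signature :: "'u set set \<Rightarrow> 't set \<Rightarrow> 'i set \<Rightarrow> ('i \<Rightarrow> 't arity) \<Rightarrow> bool" where
  "signature U T I S \<longleftrightarrow> small U I \<and> (\<forall>i\<in>I. is_arity T (S i))"

record ('t, 'u, 'i) representation = "(('t, 'u) fam, ('t, 'u) fam_map) kmonad" +
  act :: "'i \<Rightarrow> ('t, 'u) fam \<Rightarrow> 'u \<Rightarrow> 'u"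

definition is_representation ::
    "'u set set \<Rightarrow> 't set \<Rightarrow> 'i set \<Rightarrow> ('i \<Rightarrow> 't arity) \<Rightarrow> ('t, 'u, 'i) representation \<Rightarrow> bool" where
  "is_representation U T I S R \<longleftrightarrow> is_monad (TSet U T) R \<and>
     (\<forall>i\<in>I. act R i \<in> module_hom (TSet U T) R (Set_cat U) (arity_dom U T R (S i)) (arity_cod R (S i)))"

text \<open>
  Pulling back along \<open>f : P \<rightarrow> Q\<close> does not change the components of modules and of module morphisms,
  and the canonical isomorphisms between \<open>f\<^sup>*\<close> of a product, derivative or fibre and the product,
  derivative or fibre of \<open>f\<^sup>*\<close> have identities as components. So \<open>f\<^sup>*(\<alpha>\<^sup>Q)\<close> is the family \<open>act Q i\<close>, and
  the isomorphisms do not appear in the commuting square.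
\<close>

definition representation_hom ::
    "'u set set \<Rightarrow> 't set \<Rightarrow> 'i set \<Rightarrow> ('i \<Rightarrow> 't arity) \<Rightarrow>
     ('t, 'u, 'i) representation \<Rightarrow> ('t, 'u, 'i) representation \<Rightarrow>
     (('t, 'u) fam \<Rightarrow> ('t, 'u) fam_map) set" where
  "representation_hom U T I S P Q = {f \<in> monad_hom (TSet U T) P Q.
     \<forall>i\<in>I.
       comp_fam (TSet U T) (Set_cat U)
         (mob (arity_dom U T P (S i))) (mob (arity_cod P (S i))) (mob (arity_cod Q (S i)))
         (act P i) (fibre_mor (TSet U T) (snd (S i)) f) =
       comp_fam (TSet U T) (Set_cat U)
         (mob (arity_dom U T P (S i))) (mob (arity_dom U T Q (S i))) (mob (arity_cod Q (S i)))
         (arity_mor U T P (S i) f) (act Q i)}"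

definition Rep ::
    "'u set set \<Rightarrow> 't set \<Rightarrow> 'i set \<Rightarrow> ('i \<Rightarrow> 't arity) \<Rightarrow>
     (('t, 'u, 'i) representation, ('t, 'u) fam \<Rightarrow> ('t, 'u) fam_map) cat" where
  "Rep U T I S = \<lparr>Obj = {R. is_representation U T I S R},
     Hom = representation_hom U T I S,
     Ident = (\<lambda>P. \<lambda>V\<in>Obj (TSet U T). Ident (TSet U T) (ob P V)),
     Comp = (\<lambda>P Q R. comp_fam (TSet U T) (TSet U T) (ob P) (ob Q) (ob R))\<rparr>"

section \<open>Well-formedness\<close>

text \<open>
  The facts below check the definitions: \<open>ext T u V\<close> has the universal property of \<open>V + D(u)\<close>,
  the module constructions yield modules, and \<open>Rep U T I S\<close> is a category.
\<close>

lemma inj_var_code: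
  assumes "infinite (UNIV :: 'u set)"
  shows "inj (var_code :: 'u option \<Rightarrow> 'u)"
proof -
  fix a :: 'u
  obtain h where h: "bij_betw h (UNIV :: 'u set) (UNIV - {a})"
    using infinite_imp_bij_betw[OF assms] by blast
  have 1: "inj h" and 2: "h x \<noteq> a" "a \<noteq> h x" for x
    using h by (auto simp: bij_betw_def)
  have "inj (case_option a h)"
  proof (rule injI)
    fix x y assume "case_option a h x = case_option a h y"
    then show "x = y" by (cases x; cases y) (simp_all add: 2 inj_eq[OF 1])
  qed
  then show ?thesis
    unfolding var_code_def by (metis someI_ex)
qed

lemma inj_list_code:
  assumes "infinite (UNIV :: 'u set)"
  shows "inj (list_code :: 'u list \<Rightarrow> 'u)"
proof -
  obtain p :: "'u \<times> 'u \<Rightarrow> 'u" where p: "inj p"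
    using card_of_Times_same_infinite[OF assms]
    unfolding card_of_ordIso[symmetric] bij_betw_def by auto
  obtain e :: "'u option \<Rightarrow> 'u" where e: "inj e"
    using inj_var_code[OF assms] by blast
  define enc where "enc = rec_list (e None) (\<lambda>x _ y. e (Some (p (x, y))))"
  have "enc xs = enc ys \<Longrightarrow> xs = ys" for xs ys
  proof (induction xs arbitrary: ys)
    case Nil
    then show ?case using e by (cases ys) (auto simp: enc_def dest: injD)
  next
    case (Cons x xs)
    then show ?case using e p by (cases ys) (auto simp: enc_def dest!: injD)
  qed
  then have "inj enc" by (rule injI)
  then show ?thesis
    unfolding list_code_def by (metis someI_ex)
qed

lemma set_universeD:
  assumes "set_universe U"
  shows "\<lbrakk>A \<in> U; B \<subseteq> A\<rbrakk> \<Longrightarrow> B \<in> U"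
    and "A \<in> U \<Longrightarrow> f ` A \<in> U"
    and "\<lbrakk>A \<in> U; \<And>a. a \<in> A \<Longrightarrow> F a \<in> U\<rbrakk> \<Longrightarrow> (\<Union>a\<in>A. F a) \<in> U"
    and "\<exists>A\<in>U. infinite A"
  using assms unfolding set_universe_def by simp_all

lemma set_universe_infinite:
  assumes "set_universe (U :: 'u set set)"
  shows "infinite (UNIV :: 'u set)"
  using assms unfolding set_universe_def by (meson finite_subset top_greatest)

lemma set_universe_UNIV:
  assumes "infinite (UNIV :: 'u set)"
  shows "set_universe (UNIV :: 'u set set)"
  using assms unfolding set_universe_def by blast

lemma category_Set_cat: "category (Set_cat U)"
  by unfold_locales
    (auto simp: Set_cat_def compose_def restrict_def PiE_iff extensional_def fun_eq_iff)

lemma Obj_Fam_cat_mem: "\<lbrakk>V \<in> Obj (Fam_cat T D); t \<in> T\<rbrakk> \<Longrightarrow> V t \<in> Obj D"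
  and Hom_Fam_cat_mem: "\<lbrakk>f \<in> Hom (Fam_cat T D) V W; t \<in> T\<rbrakk> \<Longrightarrow> f t \<in> Hom D (V t) (W t)"
  and Hom_Fam_cat_ext: "f \<in> Hom (Fam_cat T D) V W \<Longrightarrow> f \<in> extensional T"
  unfolding Fam_cat_def by (auto dest: PiE_mem simp: PiE_def)

lemma category_Fam_cat:
  assumes "category D"
  shows "category (Fam_cat T D)"
proof -
  interpret D: category D by fact
  note mem = Obj_Fam_cat_mem[where D = D and T = T] Hom_Fam_cat_mem[where D = D and T = T]
  note Ident = Fam_cat_def[THEN arg_cong[where f = Ident], simplified]
  note Comp = Fam_cat_def[THEN arg_cong[where f = Comp], simplified]
  note Hom = Fam_cat_def[THEN arg_cong[where f = Hom], simplified]
  show ?thesis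
  proof
    fix a assume "a \<in> Obj (Fam_cat T D)"
    then show "Ident (Fam_cat T D) a \<in> Hom (Fam_cat T D) a a"
      by (simp add: Ident Hom mem D.Ident_in restrict_PiE_iff)
  next
    fix a b f
    assume *: "a \<in> Obj (Fam_cat T D)" "b \<in> Obj (Fam_cat T D)" "f \<in> Hom (Fam_cat T D) a b"
    show "Comp (Fam_cat T D) a a b (Ident (Fam_cat T D) a) f = f"
      using Hom_Fam_cat_ext[OF *(3)] D.Ident_left[OF mem(1)[OF *(1)] mem(1)[OF *(2)] mem(2)[OF *(3)]]
      by (auto simp: Ident Comp intro!: extensionalityI[of _ T])
    show "Comp (Fam_cat T D) a b b f (Ident (Fam_cat T D) b) = f"
      using Hom_Fam_cat_ext[OF *(3)] D.Ident_right[OF mem(1)[OF *(1)] mem(1)[OF *(2)] mem(2)[OF *(3)]]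
      by (auto simp: Ident Comp intro!: extensionalityI[of _ T])
  next
    fix a b c f g
    assume *: "a \<in> Obj (Fam_cat T D)" "b \<in> Obj (Fam_cat T D)" "c \<in> Obj (Fam_cat T D)"
      "f \<in> Hom (Fam_cat T D) a b" "g \<in> Hom (Fam_cat T D) b c"
    show "Comp (Fam_cat T D) a b c f g \<in> Hom (Fam_cat T D) a c"
      using D.Comp_in[OF mem(1)[OF *(1)] mem(1)[OF *(2)] mem(1)[OF *(3)] mem(2)[OF *(4)]
          mem(2)[OF *(5)]]
      by (simp add: Comp Hom restrict_PiE_iff)
    fix d h
    assume **: "d \<in> Obj (Fam_cat T D)" "h \<in> Hom (Fam_cat T D) c d"
    show "Comp (Fam_cat T D) a c d (Comp (Fam_cat T D) a b c f g) h =
        Comp (Fam_cat T D) a b d f (Comp (Fam_cat T D) b c d g h)"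
      using D.Comp_assoc[OF mem(1)[OF *(1)] mem(1)[OF *(2)] mem(1)[OF *(3)] mem(1)[OF **(1)]
          mem(2)[OF *(4)] mem(2)[OF *(5)] mem(2)[OF **(2)]]
      unfolding Comp by (intro restrict_ext) simp
  qed
qed

lemma Obj_TSet: "Obj (TSet U T) = (\<Pi>\<^sub>E t\<in>T. U)"
  and Hom_TSet: "Hom (TSet U T) V W = (\<Pi>\<^sub>E t\<in>T. V t \<rightarrow>\<^sub>E W t)"
  and Ident_TSet: "Ident (TSet U T) V = (\<lambda>t\<in>T. \<lambda>x\<in>V t. x)"
  and Comp_TSet: "Comp (TSet U T) V W X f g = (\<lambda>t\<in>T. compose (V t) (g t) (f t))"
  by (simp_all add: Fam_cat_def Set_cat_def)

lemma set_universe_finite: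
  assumes U: "set_universe U" and "finite A"
  shows "A \<in> U"
proof (cases "A = {}")
  case True
  then show ?thesis using set_universeD(1,4)[OF U] by blast
next
  case False
  obtain B where B: "B \<in> U" "infinite B" using set_universeD(4)[OF U] by blast
  obtain C where C: "C \<subseteq> B" "finite C" "card C = card A"
    using infinite_arbitrarily_large[OF B(2)] by metis
  then obtain g where "bij_betw g C A" using \<open>finite A\<close> by (meson finite_same_card_bij)
  then have "g ` C = A" by (simp add: bij_betw_def)
  then show ?thesis using set_universeD(1,2)[OF U] B(1) C(1) by blast
qed

lemma set_universe_Un:
  assumes U: "set_universe U" and "A \<in> U" "B \<in> U"
  shows "A \<union> B \<in> U"
proof -
  obtain x where "x \<in> (UNIV :: 'a set)" by blast
  obtain y where xy: "y \<noteq> x"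
    using set_universe_infinite[OF U] ex_new_if_finite[of "{x}"] by auto
  have "(\<Union>a\<in>{x, y}. if a = x then A else B) \<in> U"
    by (rule set_universeD(3)[OF U set_universe_finite[OF U]]) (use assms(2,3) in auto)
  then show ?thesis using xy by (simp add: Un_commute)
qed

lemma ext_in_Obj:
  assumes U: "set_universe U" and "V \<in> Obj (TSet U T)"
  shows "ext T u V \<in> Obj (TSet U T)"
proof -
  have "var_code ` (Some ` A \<union> B) \<in> U" if "A \<in> U" "finite B" for A and B :: "'a option set"
    unfolding image_Un image_image
    using that set_universe_Un[OF U] set_universeD(2)[OF U] set_universe_finite[OF U] by blast
  moreover have "V t \<in> U" if "t \<in> T" for t
    using assms(2) that unfolding Obj_TSet by (rule PiE_mem)
  ultimately show ?thesis unfolding ext_def Obj_TSet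
    by (intro restrict_PiE_iff[THEN iffD2] ballI) simp
qed


lemma old_in_Hom: "old T V \<in> Hom (TSet U T) V (ext T u V)"
  unfolding Hom_TSet old_def ext_def by (auto intro!: restrict_PiE_iff[THEN iffD2])

lemma copair_in_Hom:
  assumes U: "set_universe (U :: 'u set set)" and f: "f \<in> Hom (TSet U T) V W"
    and y: "u \<in> T \<Longrightarrow> y \<in> W u"
  shows "copair T u V f y \<in> Hom (TSet U T) (ext T u V) W"
proof -
  have inv: "inv var_code (var_code (x :: 'u option)) = x" for x
    using inj_var_code[OF set_universe_infinite[OF U]] by simp
  have "f t x \<in> W t" if "t \<in> T" "x \<in> V t" for t x
  proof -
    have "f t \<in> V t \<rightarrow>\<^sub>E W t" using f that(1) unfolding Hom_TSet by (rule PiE_mem)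
    then show ?thesis using that(2) by (rule PiE_mem)
  qed
  then show ?thesis
    unfolding Hom_TSet copair_def
    by (intro restrict_PiE_iff[THEN iffD2] ballI) (auto simp: ext_def inv y split: if_splits)
qed

lemma copair_unique:
  assumes U: "set_universe (U :: 'u set set)" and f: "f \<in> Hom (TSet U T) V W"
    and u: "u \<in> T" and g: "g \<in> Hom (TSet U T) (ext T u V) W"
  shows "g = copair T u V f y \<longleftrightarrow>
    Comp (TSet U T) V (ext T u V) W (old T V) g = f \<and> g u (var_code None) = y"
proof -
  have inv: "inv var_code (var_code (x :: 'u option)) = x" for x
    using inj_var_code[OF set_universe_infinite[OF U]] by simp
  have g1: "g \<in> extensional T" and g2: "\<And>t. t \<in> T \<Longrightarrow> g t \<in> extensional (ext T u V t)"
    using g unfolding Hom_TSet by (auto simp: PiE_def Pi_def)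
  have f1: "f \<in> extensional T" and f2: "\<And>t. t \<in> T \<Longrightarrow> f t \<in> extensional (V t)"
    using f unfolding Hom_TSet by (auto simp: PiE_def Pi_def)
  show ?thesis
  proof
    assume g: "g = copair T u V f y"
    have "Comp (TSet U T) V (ext T u V) W (old T V) g = f"
      unfolding Comp_TSet
    proof (rule extensionalityI[of _ T])
      fix t assume t: "t \<in> T"
      show "(\<lambda>t\<in>T. compose (V t) (g t) (old T V t)) t = f t"
        by (rule extensionalityI[of _ "V t"])
          (use t f2 in \<open>auto simp: compose_def old_def g copair_def ext_def inv\<close>)
    qed (use f1 in auto)
    then show "Comp (TSet U T) V (ext T u V) W (old T V) g = f \<and> g u (var_code None) = y"
      using u by (auto simp: g copair_def ext_def inv)
  next
    assume *: "Comp (TSet U T) V (ext T u V) W (old T V) g = f \<and> g u (var_code None) = y"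
    then have f: "f t x = g t (var_code (Some x))" if "t \<in> T" "x \<in> V t" for t x
      using that by (auto simp: Comp_TSet compose_def old_def)
    have y: "y = g u (var_code None)" using * by simp
    show "g = copair T u V f y"
    proof (rule extensionalityI[of _ T])
      fix t assume t: "t \<in> T"
      show "g t = copair T u V f y t"
        by (rule extensionalityI[of _ "ext T u V t"])
          (use t g2 in \<open>auto simp: copair_def ext_def inv f y split: if_splits\<close>)
    qed (use g1 in \<open>auto simp: copair_def\<close>)
  qed
qed

lemma category_TSet: "category (TSet U T)"
  by (intro category_Fam_cat category_Set_cat)

lemma is_monadD:
  assumes "is_monad C P"
  shows "c \<in> Obj C \<Longrightarrow> ob P c \<in> Obj C"
    and "c \<in> Obj C \<Longrightarrow> unit P c \<in> Hom C c (ob P c)"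
    and "\<lbrakk>c \<in> Obj C; d \<in> Obj C; f \<in> Hom C c (ob P d)\<rbrakk> \<Longrightarrow> subst P c d f \<in> Hom C (ob P c) (ob P d)"
    and "\<lbrakk>c \<in> Obj C; d \<in> Obj C; f \<in> Hom C c (ob P d)\<rbrakk> \<Longrightarrow>
      Comp C c (ob P c) (ob P d) (unit P c) (subst P c d f) = f"
    and "c \<in> Obj C \<Longrightarrow> subst P c c (unit P c) = Ident C (ob P c)"
    and "\<lbrakk>c \<in> Obj C; d \<in> Obj C; e \<in> Obj C; f \<in> Hom C c (ob P d); g \<in> Hom C d (ob P e)\<rbrakk> \<Longrightarrow>
      Comp C (ob P c) (ob P d) (ob P e) (subst P c d f) (subst P d e g) =
      subst P c e (Comp C c (ob P d) (ob P e) f (subst P d e g))"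
  using assms unfolding is_monad_def by simp_all

lemma is_moduleD:
  assumes "is_module C P D M"
  shows "c \<in> Obj C \<Longrightarrow> mob M c \<in> Obj D"
    and "\<lbrakk>c \<in> Obj C; d \<in> Obj C; f \<in> Hom C c (ob P d)\<rbrakk> \<Longrightarrow> msubst M c d f \<in> Hom D (mob M c) (mob M d)"
    and "c \<in> Obj C \<Longrightarrow> msubst M c c (unit P c) = Ident D (mob M c)"
    and "\<lbrakk>c \<in> Obj C; d \<in> Obj C; e \<in> Obj C; f \<in> Hom C c (ob P d); g \<in> Hom C d (ob P e)\<rbrakk> \<Longrightarrow>
      Comp D (mob M c) (mob M d) (mob M e) (msubst M c d f) (msubst M d e g) =
      msubst M c e (Comp C c (ob P d) (ob P e) f (subst P d e g))"
  using assms unfolding is_module_def by simp_all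

lemma monad_homD:
  assumes "\<tau> \<in> monad_hom C P Q"
  shows "c \<in> Obj C \<Longrightarrow> \<tau> c \<in> Hom C (ob P c) (ob Q c)"
    and "\<tau> \<in> extensional (Obj C)"
    and "c \<in> Obj C \<Longrightarrow> Comp C c (ob P c) (ob Q c) (unit P c) (\<tau> c) = unit Q c"
    and "\<lbrakk>c \<in> Obj C; d \<in> Obj C; f \<in> Hom C c (ob P d)\<rbrakk> \<Longrightarrow>
      Comp C (ob P c) (ob P d) (ob Q d) (subst P c d f) (\<tau> d) =
      Comp C (ob P c) (ob Q c) (ob Q d) (\<tau> c) (subst Q c d (Comp C c (ob P d) (ob Q d) f (\<tau> d)))"
  using assms unfolding monad_hom_def by (auto simp: PiE_def dest: PiE_mem)

lemma is_module_tautological: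
  assumes "is_monad C P"
  shows "is_module C P C (tautological P)"
  using assms unfolding is_monad_def is_module_def tautological_def by simp

lemma is_module_pullback:
  assumes "category C" and P: "is_monad C P" and Q: "is_monad C Q" and h: "h \<in> monad_hom C P Q"
    and M: "is_module C Q D M"
  shows "is_module C P D (pullback C P Q h M)"
proof -
  interpret category C by fact
  note [simp] = is_monadD[OF P] is_monadD[OF Q] is_moduleD[OF M] monad_homD[OF h]
  have [simp]: "Comp C c (ob P d) (ob Q d) f (h d) \<in> Hom C c (ob Q d)"
    if "c \<in> Obj C" "d \<in> Obj C" "f \<in> Hom C c (ob P d)" for c d f
    by (rule Comp_in[of _ "ob P d"]) (use that in simp_all)
  have "Comp C c (ob Q d) (ob Q e) (Comp C c (ob P d) (ob Q d) f (h d))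
          (subst Q d e (Comp C d (ob P e) (ob Q e) g (h e))) =
        Comp C c (ob P e) (ob Q e) (Comp C c (ob P d) (ob P e) f (subst P d e g)) (h e)"
    if "c \<in> Obj C" "d \<in> Obj C" "e \<in> Obj C" "f \<in> Hom C c (ob P d)" "g \<in> Hom C d (ob P e)"
    for c d e f g
    using that by (subst (1 2) Comp_assoc) simp_all
  then show ?thesis
    unfolding is_module_def pullback_def by simp
qed

lemma is_module_fibre:
  assumes "is_module C P (TSet U T) M" and "u \<in> T"
  shows "is_module C P (Set_cat U) (fibre u M)"
proof -
  have Comp_u: "Comp (Set_cat U) (V u) (W u) (X u) (f u) (g u) = Comp (TSet U T) V W X f g u"
    and Ident_u: "Ident (Set_cat U) (V u) = Ident (TSet U T) V u" for V W X f g
    using \<open>u \<in> T\<close> by (simp_all add: Fam_cat_def)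
  show ?thesis
    using Obj_Fam_cat_mem[OF is_moduleD(1)[OF assms(1)] assms(2)]
      Hom_Fam_cat_mem[OF is_moduleD(2)[OF assms(1)] assms(2)] is_moduleD(3,4)[OF assms(1)]
    by (simp add: is_module_def fibre_def Comp_u Ident_u)
qed

lemma mem_listset_iff: "xs \<in> listset As \<longleftrightarrow> list_all2 (\<in>) xs As"
  by (induction As arbitrary: xs) (auto simp: set_Cons_def list_all2_Cons2)

lemma inv_list_code:
  assumes "set_universe (U :: 'u set set)"
  shows "inv list_code (list_code (xs :: 'u list)) = xs"
  using inj_list_code[OF set_universe_infinite[OF assms]] by simp

lemma prod_set_in_universe:
  assumes U: "set_universe U" and "\<And>A. A \<in> set As \<Longrightarrow> A \<in> U"
  shows "prod_set As \<in> U"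
  using assms(2)
proof (induction As)
  case Nil
  then show ?case by (simp add: prod_set_def set_universe_finite[OF U])
next
  case (Cons A As)
  have "prod_set (A # As) = (\<Union>a\<in>A. (\<lambda>z. list_code (a # inv list_code z)) ` prod_set As)"
    unfolding prod_set_def by (auto simp: set_Cons_def inv_list_code[OF U] image_image)
  also have "\<dots> \<in> U"
    using Cons by (intro set_universeD(2,3)[OF U]) auto
  finally show ?case .
qed

lemma prod_map_list_code:
  assumes "set_universe (U :: 'u set set)" and "xs \<in> listset (map A l :: 'u set list)"
  shows "prod_map (map A l) (map F l) (list_code xs) = list_code (map2 F l xs)"
  using assms by (simp add: prod_map_def prod_set_def inv_list_code zip_map1 split_def comp_def)

lemma map2_in_listset:
  assumes "\<And>a. a \<in> set l \<Longrightarrow> F a \<in> A a \<rightarrow> B a" and "xs \<in> listset (map A l)"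
  shows "map2 F l xs \<in> listset (map B l)"
  using assms
proof (induction l arbitrary: xs)
  case (Cons a l)
  then show ?case by (auto simp: set_Cons_def Pi_iff)
qed simp

lemma prod_map_in_Hom:
  assumes U: "set_universe U" and "\<And>a. a \<in> set l \<Longrightarrow> F a \<in> Hom (Set_cat U) (A a) (B a)"
  shows "prod_map (map A l) (map F l) \<in> Hom (Set_cat U) (prod_set (map A l)) (prod_set (map B l))"
proof -
  have *: "\<And>a. a \<in> set l \<Longrightarrow> F a \<in> A a \<rightarrow> B a"
    using assms(2) by (simp add: Set_cat_def PiE_def)
  have "prod_map (map A l) (map F l) z \<in> prod_set (map B l)" if "z \<in> prod_set (map A l)" for z
    using that map2_in_listset[of l F A B, OF *]
    by (auto simp: prod_set_def prod_map_list_code[OF U])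
  moreover have "prod_map (map A l) (map F l) \<in> extensional (prod_set (map A l))"
    by (simp add: prod_map_def)
  ultimately show ?thesis
    by (simp add: Set_cat_def PiE_def)
qed

lemma prod_map_Comp:
  assumes U: "set_universe U" and F: "\<And>a. a \<in> set l \<Longrightarrow> F a \<in> Hom (Set_cat U) (A a) (B a)"
  shows "Comp (Set_cat U) (prod_set (map A l)) (prod_set (map B l)) Y
      (prod_map (map A l) (map F l)) (prod_map (map B l) (map G l)) =
    prod_map (map A l) (map (\<lambda>a. Comp (Set_cat U) (A a) (B a) (E a) (F a) (G a)) l)"
    (is "?L = ?R")
proof (rule extensionalityI[of _ "prod_set (map A l)"])
  have F': "\<And>a. a \<in> set l \<Longrightarrow> F a \<in> A a \<rightarrow> B a"
    using F by (simp add: Set_cat_def PiE_def)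
  fix z assume "z \<in> prod_set (map A l)"
  then obtain xs where xs: "z = list_code xs" "xs \<in> listset (map A l)"
    by (auto simp: prod_set_def)
  have "map2 G l (map2 F l xs) = map2 (\<lambda>a. compose (A a) (G a) (F a)) l xs"
    using xs(2)
  proof (induction l arbitrary: xs)
    case (Cons a l)
    then show ?case by (auto simp: set_Cons_def compose_def)
  qed simp
  then show "?L z = ?R z"
    using xs map2_in_listset[of l F A B, OF F']
    by (simp add: Set_cat_def compose_def prod_map_list_code[OF U] prod_set_def)
qed (simp_all add: prod_map_def Set_cat_def)

lemma prod_map_Ident:
  assumes U: "set_universe U"
  shows "prod_map (map A l) (map (\<lambda>a. Ident (Set_cat U) (A a)) l) =
    Ident (Set_cat U) (prod_set (map A l))" (is "?L = ?R")
proof (rule extensionalityI[of _ "prod_set (map A l)"])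
  fix z assume "z \<in> prod_set (map A l)"
  then obtain xs where xs: "z = list_code xs" "xs \<in> listset (map A l)"
    by (auto simp: prod_set_def)
  have "map2 (\<lambda>a. \<lambda>x\<in>A a. x) l xs = xs"
    using xs(2)
  proof (induction l arbitrary: xs)
    case (Cons a l)
    then show ?case by (auto simp: set_Cons_def)
  qed simp
  then show "?L z = ?R z"
    using xs by (simp add: Set_cat_def prod_map_list_code[OF U] prod_set_def)
qed (simp_all add: prod_map_def Set_cat_def)

lemma is_module_prod:
  assumes U: "set_universe U" and Ms: "\<And>M. M \<in> set Ms \<Longrightarrow> is_module C P (Set_cat U) M"
  shows "is_module C P (Set_cat U) (prod_module Ms)"
  unfolding is_module_def prod_module_def kmodule.simps
proof (intro conjI ballI)
  note mod = Ms[THEN is_moduleD(1)] Ms[THEN is_moduleD(2)] Ms[THEN is_moduleD(3)]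
    Ms[THEN is_moduleD(4)]
  fix c assume c: "c \<in> Obj C"
  show "prod_set (map (\<lambda>M. mob M c) Ms) \<in> Obj (Set_cat U)"
    using mod(1)[OF _ c] prod_set_in_universe[OF U, of "map (\<lambda>M. mob M c) Ms"]
    by (auto simp: Set_cat_def)
  show "prod_map (map (\<lambda>M. mob M c) Ms) (map (\<lambda>M. msubst M c c (unit P c)) Ms) =
      Ident (Set_cat U) (prod_set (map (\<lambda>M. mob M c) Ms))"
    unfolding prod_map_Ident[OF U, symmetric] using mod(3)[OF _ c]
    by (simp cong: map_cong)
  fix d f assume d: "d \<in> Obj C" and f: "f \<in> Hom C c (ob P d)"
  show "prod_map (map (\<lambda>M. mob M c) Ms) (map (\<lambda>M. msubst M c d f) Ms)
      \<in> Hom (Set_cat U) (prod_set (map (\<lambda>M. mob M c) Ms)) (prod_set (map (\<lambda>M. mob M d) Ms))"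
    using mod(2)[OF _ c d f] by (rule prod_map_in_Hom[OF U])
  fix e g assume e: "e \<in> Obj C" and g: "g \<in> Hom C d (ob P e)"
  show "Comp (Set_cat U) (prod_set (map (\<lambda>M. mob M c) Ms)) (prod_set (map (\<lambda>M. mob M d) Ms))
      (prod_set (map (\<lambda>M. mob M e) Ms))
      (prod_map (map (\<lambda>M. mob M c) Ms) (map (\<lambda>M. msubst M c d f) Ms))
      (prod_map (map (\<lambda>M. mob M d) Ms) (map (\<lambda>M. msubst M d e g) Ms)) =
    prod_map (map (\<lambda>M. mob M c) Ms)
      (map (\<lambda>M. msubst M c e (Comp C c (ob P d) (ob P e) f (subst P d e g))) Ms)"
    using prod_map_Comp[OF U, of Ms "\<lambda>M. msubst M c d f" "\<lambda>M. mob M c" "\<lambda>M. mob M d"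
        _ "\<lambda>M. msubst M d e g" "\<lambda>M. mob M e"] mod(2)[OF _ c d f] mod(4)[OF _ c d e f g]
    by (simp cong: map_cong)
qed

context
  fixes U :: "'u set set" and T :: "'t set"
    and P :: "(('t, 'u) fam, ('t, 'u) fam_map, 'z) kmonad_scheme" and u :: 't
  assumes U: "set_universe U" and P: "is_monad (TSet U T) P" and u: "u \<in> T"
begin

interpretation category "TSet U T" by (rule category_TSet)

private lemma Obj_intros: 
  "V \<in> Obj (TSet U T) \<Longrightarrow> ext T u V \<in> Obj (TSet U T)"
  "V \<in> Obj (TSet U T) \<Longrightarrow> ob P V \<in> Obj (TSet U T)"
  by (simp_all add: ext_in_Obj[OF U] is_monadD[OF P])

lemma lift_old_in_Hom:
  assumes "V \<in> Obj (TSet U T)"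
  shows "lift (TSet U T) P V (ext T u V) (old T V) \<in> Hom (TSet U T) (ob P V) (ob P (ext T u V))"
  unfolding lift_def using assms
  by (intro is_monadD(3)[OF P] Comp_in[of _ "ext T u V"] Obj_intros is_monadD(2)[OF P] old_in_Hom)

lemma unit_fresh:
  assumes "V \<in> Obj (TSet U T)"
  shows "unit P (ext T u V) u (var_code None) \<in> ob P (ext T u V) u"
  using is_monadD(2)[OF P Obj_intros(1)[OF assms]] u
  unfolding Hom_TSet by (auto dest!: PiE_mem[of _ _ _ u] simp: ext_def PiE_def Pi_def)

lemma shift_in_Hom:
  assumes V: "V \<in> Obj (TSet U T)" and W: "W \<in> Obj (TSet U T)"
    and f: "f \<in> Hom (TSet U T) V (ob P W)"
  shows "shift U T P u V W f \<in> Hom (TSet U T) (ext T u V) (ob P (ext T u W))"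
  unfolding shift_def using unit_fresh[OF W] assms
  by (intro copair_in_Hom[OF U] Comp_in[of _ "ob P W"] lift_old_in_Hom Obj_intros)

lemma shift_unique:
  assumes V: "V \<in> Obj (TSet U T)" and W: "W \<in> Obj (TSet U T)"
    and f: "f \<in> Hom (TSet U T) V (ob P W)"
    and g: "g \<in> Hom (TSet U T) (ext T u V) (ob P (ext T u W))"
  shows "g = shift U T P u V W f \<longleftrightarrow>
    Comp (TSet U T) V (ext T u V) (ob P (ext T u W)) (old T V) g =
      Comp (TSet U T) V (ob P W) (ob P (ext T u W)) f (lift (TSet U T) P W (ext T u W) (old T W)) \<and>
    g u (var_code None) = unit P (ext T u W) u (var_code None)"
  unfolding shift_def using assms
  by (intro copair_unique[OF U _ u] Comp_in[of _ "ob P W"] lift_old_in_Hom Obj_intros)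

lemmas shift_old = shift_unique[THEN iffD1, THEN conjunct1, OF _ _ _ shift_in_Hom refl]
  and shift_fresh = shift_unique[THEN iffD1, THEN conjunct2, OF _ _ _ shift_in_Hom refl]

lemma shift_unit:
  assumes V: "V \<in> Obj (TSet U T)"
  shows "shift U T P u V V (unit P V) = unit P (ext T u V)"
proof -
  have "Comp (TSet U T) V (ob P V) (ob P (ext T u V)) (unit P V)
      (lift (TSet U T) P V (ext T u V) (old T V)) =
    Comp (TSet U T) V (ext T u V) (ob P (ext T u V)) (old T V) (unit P (ext T u V))"
    unfolding lift_def using V
    by (intro is_monadD(4)[OF P] Comp_in[of _ "ext T u V"] Obj_intros is_monadD(2)[OF P] old_in_Hom)
  then show ?thesis
    using V by (intro shift_unique[THEN iffD2, symmetric])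
      (simp_all add: Obj_intros is_monadD(2)[OF P])
qed

lemma shift_subst:
  assumes V: "V \<in> Obj (TSet U T)" and W: "W \<in> Obj (TSet U T)" and X: "X \<in> Obj (TSet U T)"
    and f: "f \<in> Hom (TSet U T) V (ob P W)" and g: "g \<in> Hom (TSet U T) W (ob P X)"
  shows "Comp (TSet U T) (ext T u V) (ob P (ext T u W)) (ob P (ext T u X)) (shift U T P u V W f)
      (subst P (ext T u W) (ext T u X) (shift U T P u W X g)) =
    shift U T P u V X (Comp (TSet U T) V (ob P W) (ob P X) f (subst P W X g))"
proof -
  let ?C = "TSet U T" and ?e = "ext T u"
  let ?old = "\<lambda>V. lift ?C P V (?e V) (old T V)"
  let ?sg = "subst P (?e W) (?e X) (shift U T P u W X g)"
  note obj = V W X Obj_intros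
  have sf: "shift U T P u V W f \<in> Hom ?C (?e V) (ob P (?e W))"
    and sg0: "shift U T P u W X g \<in> Hom ?C (?e W) (ob P (?e X))"
    using shift_in_Hom assms by blast+
  have sg: "?sg \<in> Hom ?C (ob P (?e W)) (ob P (?e X))"
    by (intro is_monadD(3)[OF P] obj sg0)
  have g': "subst P W X g \<in> Hom ?C (ob P W) (ob P X)"
    by (intro is_monadD(3)[OF P] obj g)
  have ou: "Comp ?C W (?e W) (ob P (?e W)) (old T W) (unit P (?e W)) \<in> Hom ?C W (ob P (?e W))"
    by (intro Comp_in[of _ "?e W"] obj is_monadD(2)[OF P] old_in_Hom)
  have ou': "Comp ?C X (?e X) (ob P (?e X)) (old T X) (unit P (?e X)) \<in> Hom ?C X (ob P (?e X))"
    by (intro Comp_in[of _ "?e X"] obj is_monadD(2)[OF P] old_in_Hom)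
  have "Comp ?C (ob P W) (ob P (?e W)) (ob P (?e X)) (?old W) ?sg =
      subst P W (?e X) (Comp ?C W (ob P (?e W)) (ob P (?e X))
        (Comp ?C W (?e W) (ob P (?e W)) (old T W) (unit P (?e W))) ?sg)"
    unfolding lift_def by (intro is_monadD(6)[OF P] obj ou sg0)
  also have "\<dots> = subst P W (?e X) (Comp ?C W (?e W) (ob P (?e X)) (old T W) (shift U T P u W X g))"
    using sg sg0 by (subst Comp_assoc) (simp_all add: obj is_monadD[OF P] old_in_Hom)
  also have "\<dots> = subst P W (?e X) (Comp ?C W (ob P X) (ob P (?e X)) g (?old X))"
    by (simp add: shift_old obj g)
  also have "\<dots> = Comp ?C (ob P W) (ob P X) (ob P (?e X)) (subst P W X g) (?old X)"
    unfolding lift_def by (intro is_monadD(6)[OF P, symmetric] obj ou' g)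
  finally have *: "Comp ?C (ob P W) (ob P (?e W)) (ob P (?e X)) (?old W) ?sg =
    Comp ?C (ob P W) (ob P X) (ob P (?e X)) (subst P W X g) (?old X)" .
  show ?thesis
  proof (rule shift_unique[THEN iffD2], goal_cases)
    case 3
    show ?case by (intro Comp_in[of _ "ob P W"] obj f g')
  next
    case 4
    show ?case by (intro Comp_in[of _ "ob P (?e W)"] obj sf sg)
  next
    case 5
    have "Comp ?C V (?e V) (ob P (?e X)) (old T V)
        (Comp ?C (?e V) (ob P (?e W)) (ob P (?e X)) (shift U T P u V W f) ?sg) =
      Comp ?C V (ob P (?e W)) (ob P (?e X))
        (Comp ?C V (?e V) (ob P (?e W)) (old T V) (shift U T P u V W f)) ?sg"
      by (intro Comp_assoc[symmetric] obj old_in_Hom sf sg)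
    also have "\<dots> = Comp ?C V (ob P (?e W)) (ob P (?e X))
        (Comp ?C V (ob P W) (ob P (?e W)) f (?old W)) ?sg"
      by (simp add: shift_old obj f)
    also have "\<dots> = Comp ?C V (ob P W) (ob P (?e X)) f
        (Comp ?C (ob P W) (ob P (?e W)) (ob P (?e X)) (?old W) ?sg)"
      by (intro Comp_assoc obj f sg lift_old_in_Hom)
    also have "\<dots> = Comp ?C V (ob P X) (ob P (?e X)) (Comp ?C V (ob P W) (ob P X) f (subst P W X g))
        (?old X)"
      unfolding * by (intro Comp_assoc[symmetric] obj f g' lift_old_in_Hom)
    finally have 1: "Comp ?C V (?e V) (ob P (?e X)) (old T V)
        (Comp ?C (?e V) (ob P (?e W)) (ob P (?e X)) (shift U T P u V W f) ?sg) =
      Comp ?C V (ob P X) (ob P (?e X)) (Comp ?C V (ob P W) (ob P X) f (subst P W X g)) (?old X)" .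
    have fresh: "var_code None \<in> ?e Y u" for Y :: "('t, 'u) fam"
      using u by (simp add: ext_def)
    have "Comp ?C (?e V) (ob P (?e W)) (ob P (?e X)) (shift U T P u V W f) ?sg u (var_code None) =
        ?sg u (shift U T P u V W f u (var_code None))"
      using u fresh by (simp add: Comp_TSet compose_def)
    also have "\<dots> = ?sg u (unit P (?e W) u (var_code None))"
      by (simp add: shift_fresh obj f)
    also have "\<dots> = Comp ?C (?e W) (ob P (?e W)) (ob P (?e X)) (unit P (?e W)) ?sg u (var_code None)"
      using u fresh by (simp add: Comp_TSet compose_def)
    also have "\<dots> = shift U T P u W X g u (var_code None)"
      by (simp add: is_monadD(4)[OF P] obj sg0)
    also have "\<dots> = unit P (?e X) u (var_code None)"
      by (simp add: shift_fresh obj g)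
    finally show ?case using 1 by blast
  qed (use obj in auto)
qed

lemma is_module_derived:
  assumes "is_module (TSet U T) P D M"
  shows "is_module (TSet U T) P D (derived U T P u M)"
  unfolding is_module_def derived_def kmodule.simps
proof (intro conjI ballI)
  note M = is_moduleD[OF assms]
  fix V assume V: "V \<in> Obj (TSet U T)"
  show "mob M (ext T u V) \<in> Obj D" by (intro M(1) Obj_intros V)
  show "msubst M (ext T u V) (ext T u V) (shift U T P u V V (unit P V)) =
      Ident D (mob M (ext T u V))"
    unfolding shift_unit[OF V] by (intro M(3) Obj_intros V)
  fix W f assume W: "W \<in> Obj (TSet U T)" and f: "f \<in> Hom (TSet U T) V (ob P W)"
  show "msubst M (ext T u V) (ext T u W) (shift U T P u V W f)
      \<in> Hom D (mob M (ext T u V)) (mob M (ext T u W))"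
    by (intro M(2) shift_in_Hom Obj_intros V W f)
  fix X g assume X: "X \<in> Obj (TSet U T)" and g: "g \<in> Hom (TSet U T) W (ob P X)"
  show "Comp D (mob M (ext T u V)) (mob M (ext T u W)) (mob M (ext T u X))
      (msubst M (ext T u V) (ext T u W) (shift U T P u V W f))
      (msubst M (ext T u W) (ext T u X) (shift U T P u W X g)) =
    msubst M (ext T u V) (ext T u X)
      (shift U T P u V X (Comp (TSet U T) V (ob P W) (ob P X) f (subst P W X g)))"
    unfolding shift_subst[OF V W X f g, symmetric]
    by (intro M(4) shift_in_Hom Obj_intros V W X f g)
qed

end

lemma is_module_derived_list:
  assumes "set_universe U" and "is_monad (TSet U T) P" and "set ss \<subseteq> T"
    and "is_module (TSet U T) P D M"
  shows "is_module (TSet U T) P D (derived_list U T P ss M)"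
  using assms(3,4) unfolding derived_list_def
  by (induction ss arbitrary: M) (auto intro: is_module_derived[OF assms(1,2)])

lemma is_module_arity:
  assumes "set_universe U" and "is_monad (TSet U T) R" and "is_arity T \<alpha>"
  shows "is_module (TSet U T) R (Set_cat U) (arity_dom U T R \<alpha>)"
    and "is_module (TSet U T) R (Set_cat U) (arity_cod R \<alpha>)"
proof -
  note taut = is_module_tautological[OF assms(2)]
  show "is_module (TSet U T) R (Set_cat U) (arity_cod R \<alpha>)"
    using assms(3) unfolding arity_cod_def is_arity_def
    by (intro is_module_fibre[OF taut]) auto
  show "is_module (TSet U T) R (Set_cat U) (arity_dom U T R \<alpha>)"
    unfolding arity_dom_def
  proof (rule is_module_prod[OF assms(1)])
    fix M assume "M \<in> set (arity_args U T R \<alpha>)"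
    then obtain ss t where "(ss, t) \<in> set (fst \<alpha>)"
      and M: "M = fibre t (derived_list U T R ss (tautological R))"
      by (auto simp: arity_args_def)
    with assms(3) have "set ss \<subseteq> T" "t \<in> T"
      by (force simp: is_arity_def lists_eq_set)+
    then show "is_module (TSet U T) R (Set_cat U) M"
      unfolding M by (rule is_module_fibre[OF is_module_derived_list[OF assms(1,2) _ taut]])
  qed
qed

lemma mob_derived_list: "mob (derived_list U T P ss M) V = mob M (foldr (ext T) ss V)"
  unfolding derived_list_def by (induction ss arbitrary: M) (simp_all add: derived_def)

lemma exts_in_Obj:
  assumes "set_universe U" and "V \<in> Obj (TSet U T)"
  shows "foldr (ext T) ss V \<in> Obj (TSet U T)"
  by (induction ss) (simp_all add: assms ext_in_Obj)

lemma derived_list_mor_apply: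
  assumes "set_universe U" and "V \<in> Obj (TSet U T)"
  shows "derived_list_mor U T ss \<rho> V = \<rho> (foldr (ext T) ss V)"
  unfolding derived_list_mor_def
  by (induction ss arbitrary: \<rho>) (simp_all add: derived_mor_def exts_in_Obj[OF assms])

lemma mob_arity_dom:
  "mob (arity_dom U T R \<alpha>) V = prod_set (map (\<lambda>(ss, t). ob R (foldr (ext T) ss V) t) (fst \<alpha>))"
  unfolding arity_dom_def arity_args_def
  by (simp add: prod_module_def comp_def fibre_def mob_derived_list tautological_def split_def)

lemma mob_arity_cod: "mob (arity_cod R \<alpha>) V = ob R V (snd \<alpha>)"
  by (simp add: arity_cod_def fibre_def tautological_def)

lemma arity_mor_apply:
  assumes "set_universe U" and "V \<in> Obj (TSet U T)"
  shows "arity_mor U T P \<alpha> f V =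
    prod_map (map (\<lambda>(ss, t). ob P (foldr (ext T) ss V) t) (fst \<alpha>))
      (map (\<lambda>(ss, t). f (foldr (ext T) ss V) t) (fst \<alpha>))"
  using assms unfolding arity_mor_def arity_args_def
  by (simp add: prod_mor_def comp_def fibre_def fibre_mor_def mob_derived_list tautological_def
      derived_list_mor_apply split_def)

lemma representation_hom_iff:
  "f \<in> representation_hom U T I S P Q \<longleftrightarrow> f \<in> monad_hom (TSet U T) P Q \<and>
    (\<forall>i\<in>I. \<forall>V\<in>Obj (TSet U T).
      Comp (Set_cat U) (mob (arity_dom U T P (S i)) V) (mob (arity_cod P (S i)) V)
        (mob (arity_cod Q (S i)) V) (act P i V) (f V (snd (S i))) =
      Comp (Set_cat U) (mob (arity_dom U T P (S i)) V) (mob (arity_dom U T Q (S i)) V)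
        (mob (arity_cod Q (S i)) V) (arity_mor U T P (S i) f V) (act Q i V))"
  unfolding representation_hom_def comp_fam_def fibre_mor_def restrict_def fun_eq_iff by auto

lemma Ident_in_monad_hom:
  assumes "category C" and P: "is_monad C P"
  shows "(\<lambda>c\<in>Obj C. Ident C (ob P c)) \<in> monad_hom C P P"
proof -
  interpret category C by fact
  note P = is_monadD[OF P]
  show ?thesis
    unfolding monad_hom_def mem_Collect_eq
  proof (intro conjI ballI)
    show "(\<lambda>c\<in>Obj C. Ident C (ob P c)) \<in> (\<Pi>\<^sub>E c\<in>Obj C. Hom C (ob P c) (ob P c))"
      by (simp add: restrict_PiE_iff P Ident_in)
  next
    fix c d f assume c: "c \<in> Obj C" and d: "d \<in> Obj C" and f: "f \<in> Hom C c (ob P d)"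
    have "Comp C c (ob P d) (ob P d) f (Ident C (ob P d)) = f"
      by (intro Ident_right P c d f)
    then show "Comp C (ob P c) (ob P d) (ob P d) (subst P c d f) ((\<lambda>c\<in>Obj C. Ident C (ob P c)) d) =
        Comp C (ob P c) (ob P c) (ob P d) ((\<lambda>c\<in>Obj C. Ident C (ob P c)) c)
         (subst P c d (Comp C c (ob P d) (ob P d) f ((\<lambda>c\<in>Obj C. Ident C (ob P c)) d)))"
      using c d f by (simp add: P Ident_left Ident_right)
  qed (simp add: P Ident_right)
qed

lemma comp_in_monad_hom:
  assumes "category C" and P: "is_monad C P" and Q: "is_monad C Q" and R: "is_monad C R"
    and f: "f \<in> monad_hom C P Q" and g: "g \<in> monad_hom C Q R"
  shows "comp_fam C C (ob P) (ob Q) (ob R) f g \<in> monad_hom C P R"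
proof -
  interpret category C by fact
  note P = is_monadD[OF P] and Q = is_monadD[OF Q] and R = is_monadD[OF R]
    and f = monad_homD[OF f] and g = monad_homD[OF g]
  show ?thesis
    unfolding monad_hom_def mem_Collect_eq
  proof (intro conjI ballI)
    show "comp_fam C C (ob P) (ob Q) (ob R) f g \<in> (\<Pi>\<^sub>E c\<in>Obj C. Hom C (ob P c) (ob R c))"
      unfolding comp_fam_def restrict_PiE_iff
      by (intro ballI Comp_in[of _ "ob Q c" for c] P(1) Q(1) R(1) f(1) g(1))
  next
    fix c assume c: "c \<in> Obj C"
    have "Comp C c (ob P c) (ob R c) (unit P c) (Comp C (ob P c) (ob Q c) (ob R c) (f c) (g c)) =
        Comp C c (ob Q c) (ob R c) (Comp C c (ob P c) (ob Q c) (unit P c) (f c)) (g c)"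
      by (intro Comp_assoc[symmetric] P(1,2) Q(1) R(1) f(1) g(1) c)
    then show "Comp C c (ob P c) (ob R c) (unit P c) (comp_fam C C (ob P) (ob Q) (ob R) f g c) = unit R c"
      using c by (simp add: comp_fam_def f(3) g(3))
  next
    fix c d h assume c: "c \<in> Obj C" and d: "d \<in> Obj C" and h: "h \<in> Hom C c (ob P d)"
    let ?hf = "Comp C c (ob P d) (ob Q d) h (f d)"
    let ?hfg = "Comp C c (ob Q d) (ob R d) ?hf (g d)"
    note obj = P(1) Q(1) R(1) c d
    have hf: "?hf \<in> Hom C c (ob Q d)" by (intro Comp_in[of _ "ob P d"] obj h f(1))
    have hfg: "?hfg \<in> Hom C c (ob R d)" by (intro Comp_in[of _ "ob Q d"] obj hf g(1))
    have assoc: "Comp C c (ob P d) (ob R d) h (Comp C (ob P d) (ob Q d) (ob R d) (f d) (g d)) = ?hfg"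
      by (intro Comp_assoc[symmetric] obj h f(1) g(1))
    have "Comp C (ob P c) (ob P d) (ob R d) (subst P c d h)
          (Comp C (ob P d) (ob Q d) (ob R d) (f d) (g d)) =
        Comp C (ob P c) (ob Q d) (ob R d)
          (Comp C (ob P c) (ob P d) (ob Q d) (subst P c d h) (f d)) (g d)"
      by (intro Comp_assoc[symmetric] obj P(3) h f(1) g(1))
    also have "\<dots> = Comp C (ob P c) (ob Q d) (ob R d)
          (Comp C (ob P c) (ob Q c) (ob Q d) (f c) (subst Q c d ?hf)) (g d)"
      by (simp add: f(4) c d h)
    also have "\<dots> = Comp C (ob P c) (ob Q c) (ob R d) (f c)
          (Comp C (ob Q c) (ob Q d) (ob R d) (subst Q c d ?hf) (g d))"
      by (intro Comp_assoc obj Q(3) hf f(1) g(1))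
    also have "\<dots> = Comp C (ob P c) (ob Q c) (ob R d) (f c)
          (Comp C (ob Q c) (ob R c) (ob R d) (g c) (subst R c d ?hfg))"
      by (simp add: g(4) c d hf)
    also have "\<dots> = Comp C (ob P c) (ob R c) (ob R d)
          (Comp C (ob P c) (ob Q c) (ob R c) (f c) (g c)) (subst R c d ?hfg)"
      by (intro Comp_assoc[symmetric] obj R(3) hfg f(1) g(1))
    finally show "Comp C (ob P c) (ob P d) (ob R d) (subst P c d h)
          (comp_fam C C (ob P) (ob Q) (ob R) f g d) =
        Comp C (ob P c) (ob R c) (ob R d) (comp_fam C C (ob P) (ob Q) (ob R) f g c)
          (subst R c d (Comp C c (ob P d) (ob R d) h (comp_fam C C (ob P) (ob Q) (ob R) f g d)))"
      using c d by (simp add: comp_fam_def assoc)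
  qed
qed

lemma is_representationD:
  assumes "is_representation U T I S R"
  shows "is_monad (TSet U T) R"
    and "\<lbrakk>i \<in> I; V \<in> Obj (TSet U T)\<rbrakk> \<Longrightarrow>
      act R i V \<in> Hom (Set_cat U) (mob (arity_dom U T R (S i)) V) (mob (arity_cod R (S i)) V)"
proof -
  show "is_monad (TSet U T) R" using assms by (simp add: is_representation_def)
  assume "i \<in> I" and V: "V \<in> Obj (TSet U T)"
  then have "act R i \<in> (\<Pi>\<^sub>E V\<in>Obj (TSet U T).
      Hom (Set_cat U) (mob (arity_dom U T R (S i)) V) (mob (arity_cod R (S i)) V))"
    using assms by (simp add: is_representation_def module_hom_def)
  then show "act R i V \<in> Hom (Set_cat U) (mob (arity_dom U T R (S i)) V) (mob (arity_cod R (S i)) V)"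
    using V by (rule PiE_mem)
qed

context
  fixes U :: "'u set set" and T :: "'t set" and I :: "'i set" and S :: "'i \<Rightarrow> 't arity"
  assumes U: "set_universe U" and S: "signature U T I S"
begin

interpretation B: category "TSet U T" by (rule category_TSet)
interpretation Sets: category "Set_cat U" by (rule category_Set_cat)

private lemma arity: "i \<in> I \<Longrightarrow> is_arity T (S i)"
  using S by (simp add: signature_def)

private lemma arg_in_T: "i \<in> I \<Longrightarrow> (ss, t) \<in> set (fst (S i)) \<Longrightarrow> t \<in> T"
  and cod_in_T: "i \<in> I \<Longrightarrow> snd (S i) \<in> T"
  using arity[of i] by (force simp: is_arity_def lists_eq_set)+

private lemma arity_mor_in_Hom:
  assumes P: "is_monad (TSet U T) P" and f: "f \<in> monad_hom (TSet U T) P Q"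
    and i: "i \<in> I" and V: "V \<in> Obj (TSet U T)"
  shows "arity_mor U T P (S i) f V
    \<in> Hom (Set_cat U) (mob (arity_dom U T P (S i)) V) (mob (arity_dom U T Q (S i)) V)"
  unfolding arity_mor_apply[OF U V] mob_arity_dom
  using Hom_Fam_cat_mem[OF monad_homD(1)[OF f exts_in_Obj[OF U V]] arg_in_T[OF i]]
  by (intro prod_map_in_Hom[OF U]) auto

private lemma arity_mor_Comp:
  assumes P: "is_monad (TSet U T) P" and f: "f \<in> monad_hom (TSet U T) P Q"
    and i: "i \<in> I" and V: "V \<in> Obj (TSet U T)"
  shows "arity_mor U T P (S i) (comp_fam (TSet U T) (TSet U T) (ob P) (ob Q) (ob R) f g) V =
    Comp (Set_cat U) (mob (arity_dom U T P (S i)) V) (mob (arity_dom U T Q (S i)) V)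
      (mob (arity_dom U T R (S i)) V) (arity_mor U T P (S i) f V) (arity_mor U T Q (S i) g V)"
proof -
  have "comp_fam (TSet U T) (TSet U T) (ob P) (ob Q) (ob R) f g (foldr (ext T) ss V) t =
      Comp (Set_cat U) (ob P (foldr (ext T) ss V) t) (ob Q (foldr (ext T) ss V) t)
        (ob R (foldr (ext T) ss V) t) (f (foldr (ext T) ss V) t) (g (foldr (ext T) ss V) t)"
    if "(ss, t) \<in> set (fst (S i))" for ss t
    using exts_in_Obj[OF U V] arg_in_T[OF i that] by (simp add: comp_fam_def Fam_cat_def)
  then have eq: "map (\<lambda>(ss, t). comp_fam (TSet U T) (TSet U T) (ob P) (ob Q) (ob R) f g
        (foldr (ext T) ss V) t) (fst (S i)) =
    map (\<lambda>p. Comp (Set_cat U) (case p of (ss, t) \<Rightarrow> ob P (foldr (ext T) ss V) t)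
        (case p of (ss, t) \<Rightarrow> ob Q (foldr (ext T) ss V) t)
        (case p of (ss, t) \<Rightarrow> ob R (foldr (ext T) ss V) t)
        (case p of (ss, t) \<Rightarrow> f (foldr (ext T) ss V) t)
        (case p of (ss, t) \<Rightarrow> g (foldr (ext T) ss V) t)) (fst (S i))"
    by auto
  show ?thesis
    unfolding arity_mor_apply[OF U V] mob_arity_dom eq
    using Hom_Fam_cat_mem[OF monad_homD(1)[OF f exts_in_Obj[OF U V]] arg_in_T[OF i]]
    by (intro prod_map_Comp[OF U, symmetric]) auto
qed

private lemma arity_mor_Ident:
  assumes i: "i \<in> I" and V: "V \<in> Obj (TSet U T)"
  shows "arity_mor U T P (S i) (\<lambda>V\<in>Obj (TSet U T). Ident (TSet U T) (ob P V)) V =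
    Ident (Set_cat U) (mob (arity_dom U T P (S i)) V)"
proof -
  have eq: "map (\<lambda>(ss, t). (\<lambda>V\<in>Obj (TSet U T). Ident (TSet U T) (ob P V)) (foldr (ext T) ss V) t)
      (fst (S i)) =
    map (\<lambda>p. Ident (Set_cat U) (case p of (ss, t) \<Rightarrow> ob P (foldr (ext T) ss V) t)) (fst (S i))"
    using exts_in_Obj[OF U V] arg_in_T[OF i] by (auto simp: Fam_cat_def)
  show ?thesis
    unfolding arity_mor_apply[OF U V] mob_arity_dom eq by (rule prod_map_Ident[OF U])
qed

lemma category_Rep: "category (Rep U T I S)"
proof
  fix P assume "P \<in> Obj (Rep U T I S)"
  then have P: "is_representation U T I S P" by (simp add: Rep_def)
  note monad = is_representationD(1)[OF P]
  have "Comp (Set_cat U) (mob (arity_dom U T P (S i)) V) (mob (arity_cod P (S i)) V)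
        (mob (arity_cod P (S i)) V) (act P i V) (Ident (TSet U T) (ob P V) (snd (S i))) =
      Comp (Set_cat U) (mob (arity_dom U T P (S i)) V) (mob (arity_dom U T P (S i)) V)
        (mob (arity_cod P (S i)) V) (Ident (Set_cat U) (mob (arity_dom U T P (S i)) V)) (act P i V)"
    if i: "i \<in> I" and V: "V \<in> Obj (TSet U T)" for i V
  proof -
    note dom = is_moduleD(1)[OF is_module_arity(1)[OF U monad arity[OF i]] V]
    note cod = is_moduleD(1)[OF is_module_arity(2)[OF U monad arity[OF i]] V]
    have "Ident (TSet U T) (ob P V) (snd (S i)) = Ident (Set_cat U) (mob (arity_cod P (S i)) V)"
      using cod_in_T[OF i] by (simp add: Fam_cat_def mob_arity_cod)
    then show ?thesis
      using Sets.Ident_left[OF dom cod is_representationD(2)[OF P i V]]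
        Sets.Ident_right[OF dom cod is_representationD(2)[OF P i V]] by simp
  qed
  then show "Ident (Rep U T I S) P \<in> Hom (Rep U T I S) P P"
    by (simp add: Rep_def representation_hom_iff Ident_in_monad_hom[OF category_TSet monad]
        arity_mor_Ident)
next
  fix P Q f
  assume "P \<in> Obj (Rep U T I S)" "Q \<in> Obj (Rep U T I S)" "f \<in> Hom (Rep U T I S) P Q"
  then have P: "is_monad (TSet U T) P" and Q: "is_monad (TSet U T) Q"
    and f: "f \<in> monad_hom (TSet U T) P Q"
    by (simp_all add: Rep_def is_representation_def representation_hom_iff)
  note obj = is_monadD(1)[OF P] is_monadD(1)[OF Q]
  show "Comp (Rep U T I S) P P Q (Ident (Rep U T I S) P) f = f"
    and "Comp (Rep U T I S) P Q Q f (Ident (Rep U T I S) Q) = f"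
    using monad_homD(1,2)[OF f] obj
    by (auto simp: Rep_def comp_fam_def B.Ident_left B.Ident_right
        intro!: extensionalityI[of _ "Obj (TSet U T)"])
next
  fix P Q R f g
  assume *: "P \<in> Obj (Rep U T I S)" "Q \<in> Obj (Rep U T I S)" "R \<in> Obj (Rep U T I S)"
    "f \<in> Hom (Rep U T I S) P Q" "g \<in> Hom (Rep U T I S) Q R"
  then have rep: "is_representation U T I S P" "is_representation U T I S Q"
      "is_representation U T I S R"
    and hom: "f \<in> representation_hom U T I S P Q" "g \<in> representation_hom U T I S Q R"
    by (simp_all add: Rep_def)
  note P = is_representationD(1)[OF rep(1)] and Q = is_representationD(1)[OF rep(2)]
    and R = is_representationD(1)[OF rep(3)]
  have f: "f \<in> monad_hom (TSet U T) P Q" and g: "g \<in> monad_hom (TSet U T) Q R"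
    using hom by (simp_all add: representation_hom_iff)
  let ?D = "Set_cat U" and ?fg = "comp_fam (TSet U T) (TSet U T) (ob P) (ob Q) (ob R) f g"
  have "Comp ?D (mob (arity_dom U T P (S i)) V) (mob (arity_cod P (S i)) V)
        (mob (arity_cod R (S i)) V) (act P i V) (?fg V (snd (S i))) =
      Comp ?D (mob (arity_dom U T P (S i)) V) (mob (arity_dom U T R (S i)) V)
        (mob (arity_cod R (S i)) V) (arity_mor U T P (S i) ?fg V) (act R i V)"
    if i: "i \<in> I" and V: "V \<in> Obj (TSet U T)" for i V
  proof -
    let ?dP = "mob (arity_dom U T P (S i)) V" and ?cP = "mob (arity_cod P (S i)) V"
      and ?dQ = "mob (arity_dom U T Q (S i)) V" and ?cQ = "mob (arity_cod Q (S i)) V"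
      and ?dR = "mob (arity_dom U T R (S i)) V" and ?cR = "mob (arity_cod R (S i)) V"
      and ?f = "f V (snd (S i))" and ?g = "g V (snd (S i))"
      and ?af = "arity_mor U T P (S i) f V" and ?ag = "arity_mor U T Q (S i) g V"
    have obj: "?dP \<in> Obj ?D" "?cP \<in> Obj ?D" "?dQ \<in> Obj ?D" "?cQ \<in> Obj ?D" "?dR \<in> Obj ?D" "?cR \<in> Obj ?D"
      by (rule is_moduleD(1)[OF is_module_arity(1)[OF U _ arity[OF i]] V]
          is_moduleD(1)[OF is_module_arity(2)[OF U _ arity[OF i]] V], rule P Q R)+
    have act: "act P i V \<in> Hom ?D ?dP ?cP" "act Q i V \<in> Hom ?D ?dQ ?cQ" "act R i V \<in> Hom ?D ?dR ?cR"
      by (rule is_representationD(2)[OF _ i V], rule rep)+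
    have f': "?f \<in> Hom ?D ?cP ?cQ" and g': "?g \<in> Hom ?D ?cQ ?cR"
      unfolding mob_arity_cod
      using Hom_Fam_cat_mem[OF monad_homD(1)[OF f V] cod_in_T[OF i]]
        Hom_Fam_cat_mem[OF monad_homD(1)[OF g V] cod_in_T[OF i]] by simp_all
    have af: "?af \<in> Hom ?D ?dP ?dQ" and ag: "?ag \<in> Hom ?D ?dQ ?dR"
      by (rule arity_mor_in_Hom[OF P f i V], rule arity_mor_in_Hom[OF Q g i V])
    have sq1: "Comp ?D ?dP ?cP ?cQ (act P i V) ?f = Comp ?D ?dP ?dQ ?cQ ?af (act Q i V)"
      and sq2: "Comp ?D ?dQ ?cQ ?cR (act Q i V) ?g = Comp ?D ?dQ ?dR ?cR ?ag (act R i V)"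
      using hom i V by (simp_all add: representation_hom_iff)
    have "?fg V (snd (S i)) = Comp ?D ?cP ?cQ ?cR ?f ?g"
      using V cod_in_T[OF i] by (simp add: comp_fam_def Fam_cat_def mob_arity_cod)
    then have "Comp ?D ?dP ?cP ?cR (act P i V) (?fg V (snd (S i))) =
        Comp ?D ?dP ?cQ ?cR (Comp ?D ?dP ?cP ?cQ (act P i V) ?f) ?g"
      using Sets.Comp_assoc[OF obj(1,2,4,6) act(1) f' g'] by simp
    also have "\<dots> = Comp ?D ?dP ?dQ ?cR ?af (Comp ?D ?dQ ?cQ ?cR (act Q i V) ?g)"
      using Sets.Comp_assoc[OF obj(1,3,4,6) af act(2) g'] sq1 by simp
    also have "\<dots> = Comp ?D ?dP ?dR ?cR (Comp ?D ?dP ?dQ ?dR ?af ?ag) (act R i V)"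
      using Sets.Comp_assoc[OF obj(1,3,5,6) af ag act(3)] sq2 by simp
    finally show ?thesis by (simp add: arity_mor_Comp[OF P f i V])
  qed
  then show "Comp (Rep U T I S) P Q R f g \<in> Hom (Rep U T I S) P R"
    by (simp add: Rep_def representation_hom_iff comp_in_monad_hom[OF category_TSet P Q R f g])
  fix X h assume "X \<in> Obj (Rep U T I S)" "h \<in> Hom (Rep U T I S) R X"
  then have X: "is_monad (TSet U T) X" and h: "h \<in> monad_hom (TSet U T) R X"
    by (simp_all add: Rep_def is_representation_def representation_hom_iff)
  show "Comp (Rep U T I S) P R X (Comp (Rep U T I S) P Q R f g) h =
      Comp (Rep U T I S) P Q X f (Comp (Rep U T I S) Q R X g h)"
    using B.Comp_assoc[OF is_monadD(1)[OF P] is_monadD(1)[OF Q] is_monadD(1)[OF R]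
        is_monadD(1)[OF X] monad_homD(1)[OF f] monad_homD(1)[OF g] monad_homD(1)[OF h]]
    by (simp add: Rep_def comp_fam_def cong: restrict_cong)
qed

end

end

theory Submission
  imports Defs
begin

text \<open>
  \<open>\<Sigma>(S)\<close> consists of the well-typed terms over \<open>S\<close>, coded inside the universe, with simultaneous
  capture-avoiding substitution as monad structure and the operations of \<open>S\<close> as representation.
  A morphism to a representation \<open>Q\<close> has to send variables to units of \<open>Q\<close> and operations to the
  actions of \<open>Q\<close>, so it exists and is unique by recursion on terms; that it respects substitution
  is proved first for renamings, because lifting a substitution under a binder involves weakening.
\<close>

text \<open>Since \<open>ext\<close> keeps \<open>V + D(u)\<close> inside the type
  \<open>'u\<close>, a single datatype with variables in \<open>'u\<close> serves all contexts:
  under a binder \<open>var_code None\<close> is the new variable and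
  \<open>var_code (Some x)\<close> the old \<open>x\<close>, a nameless syntax. Contexts and types
  are data here, so typing is a predicate and substitution acts on raw terms. The fusion laws hold
  for all raw terms, but a morphism fixes a substitution only on the members of a context, so
  whatever relates terms to morphisms is restricted to well-typed terms.

  The values of the monad must be members of \<open>U\<close>, which need not be closed under power
  sets. Membership is therefore obtained by stratifying terms by size: each stage is covered by
  finite products and a union over \<open>I\<close>, and the stages are indexed by the natural
  numbers, a small set because \<open>U\<close> has an infinite member.

  The abstract \<open>shift\<close>, a copairing built from \<open>subst\<close> and
  \<open>unit\<close>, has to be matched with the syntactic lifting twice: inside the term monad,
  where this makes the operations module morphisms, and across the interpretation in
  \<open>Q\<close>, where it makes the interpretation a monad morphism.\<close>

section \<open>Families of maps and lists\<close>

text \<open>A normal form for morphisms of \<open>TSet\<close>: identities and composites take this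
  shape, so that equations between them reduce to values on members by
  \<open>fam_fun_cong\<close>.\<close>

definition fam_fun :: "'t set \<Rightarrow> ('t, 'u) fam \<Rightarrow> ('t, 'u) fam_map \<Rightarrow> ('t, 'u) fam_map" where
  "fam_fun T V F = (\<lambda>t\<in>T. \<lambda>x\<in>V t. F t x)"

lemma fam_fun_apply [simp]: "\<lbrakk>t \<in> T; x \<in> V t\<rbrakk> \<Longrightarrow> fam_fun T V F t x = F t x"
  by (simp add: fam_fun_def)

lemma fam_fun_cong:
  "(\<And>t x. \<lbrakk>t \<in> T; x \<in> V t\<rbrakk> \<Longrightarrow> F t x = G t x) \<Longrightarrow> fam_fun T V F = fam_fun T V G"
  unfolding fam_fun_def by (intro restrict_ext) simp

lemma fam_fun_in_Hom:
  "fam_fun T V F \<in> Hom (TSet U T) V W \<longleftrightarrow> (\<forall>t\<in>T. \<forall>x\<in>V t. F t x \<in> W t)"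
  by (simp only: fam_fun_def Hom_TSet restrict_PiE_iff)

lemma Hom_TSet_apply: "\<lbrakk>f \<in> Hom (TSet U T) V W; t \<in> T; x \<in> V t\<rbrakk> \<Longrightarrow> f t x \<in> W t"
  unfolding Hom_TSet by (meson PiE_mem)

lemma fam_fun_eta:
  assumes "f \<in> Hom (TSet U T) V W"
  shows "fam_fun T V f = f"
  using assms unfolding fam_fun_def Hom_TSet
  by (auto simp: fun_eq_iff restrict_def PiE_def Pi_def extensional_def)

lemma Comp_TSet_fam_fun: "Comp (TSet U T) V W X f g = fam_fun T V (\<lambda>t x. g t (f t x))"
  by (simp add: Comp_TSet fam_fun_def compose_def)

lemma Ident_TSet_fam_fun: "Ident (TSet U T) V = fam_fun T V (\<lambda>t x. x)"
  by (simp add: Ident_TSet fam_fun_def)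

lemma compose_eq_iff: "compose A g f = compose A g' f' \<longleftrightarrow> (\<forall>x\<in>A. g (f x) = g' (f' x))"
  unfolding compose_def restrict_def fun_eq_iff by auto

lemma Obj_TSet_apply: "\<lbrakk>V \<in> Obj (TSet U T); t \<in> T\<rbrakk> \<Longrightarrow> V t \<in> U"
  unfolding Obj_TSet by (rule PiE_mem)

lemma ext_mem_iff:
  "t \<in> T \<Longrightarrow> z \<in> ext T u V t \<longleftrightarrow> z = var_code None \<and> t = u \<or> (\<exists>x\<in>V t. z = var_code (Some x))"
  by (auto simp: ext_def)

text \<open>Fuses two successive traversals of an argument list along the same arity list
  \<open>xs\<close>, the shape in which composites of renamings, substitutions and interpretations
  appear at an operation.\<close>

lemma map_zip_map_zip: "map f (zip xs (map g (zip xs ys))) = map (\<lambda>p. f (fst p, g p)) (zip xs ys)"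
proof (induction xs arbitrary: ys)
  case (Cons x xs)
  then show ?case by (cases ys) simp_all
qed simp

lemma map_zip_cong:
  "(\<And>p. snd p \<in> set ys \<Longrightarrow> f p = g p) \<Longrightarrow> map f (zip xs ys) = map g (zip xs ys)"
  by (auto dest: set_zip_rightD)

lemma map2_cong_list_all2:
  "\<lbrakk>list_all2 P ys xs; \<And>x y. \<lbrakk>x \<in> set xs; y \<in> set ys; P y x\<rbrakk> \<Longrightarrow> f x y = g x y\<rbrakk>
    \<Longrightarrow> map2 f xs ys = map2 g xs ys"
  by (induction rule: list_all2_induct) auto

lemma list_all2_map2I:
  "\<lbrakk>list_all2 P ys xs; \<And>x y. \<lbrakk>x \<in> set xs; y \<in> set ys; P y x\<rbrakk> \<Longrightarrow> Q (f x y) x\<rbrakk>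
    \<Longrightarrow> list_all2 Q (map2 f xs ys) xs"
  by (induction rule: list_all2_induct) auto

lemma list_all2_memD:
  "\<lbrakk>list_all2 P ys xs; y \<in> set ys\<rbrakk> \<Longrightarrow> \<exists>x\<in>set xs. P y x"
  by (induction rule: list_all2_induct) auto

lemma map2_eq_map:
  "\<lbrakk>list_all2 P ys xs; \<And>x y. \<lbrakk>x \<in> set xs; y \<in> set ys; P y x\<rbrakk> \<Longrightarrow> f x y = g y\<rbrakk>
    \<Longrightarrow> map2 f xs ys = map g ys"
  by (induction rule: list_all2_induct) auto

lemma listset_map_iff: "xs \<in> listset (map A l) \<longleftrightarrow> list_all2 (\<lambda>x p. x \<in> A p) xs l"
  by (simp add: mem_listset_iff list_all2_map2)

section \<open>Iterated derivation\<close>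

text \<open>\<open>derived_list\<close> is a left fold, so the head of the list is the derivation
  closest to \<open>M\<close> and its variable the outermost extension of the context. Hence
  \<open>shift\<close> at the head is applied last.\<close>

primrec shifts ::
    "'u set set \<Rightarrow> 't set \<Rightarrow> (('t, 'u) fam, ('t, 'u) fam_map, 'z) kmonad_scheme \<Rightarrow> 't list \<Rightarrow>
     ('t, 'u) fam \<Rightarrow> ('t, 'u) fam \<Rightarrow> ('t, 'u) fam_map \<Rightarrow> ('t, 'u) fam_map" where
  "shifts U T P [] V W f = f"
| "shifts U T P (u # ss) V W f =
     shift U T P u (foldr (ext T) ss V) (foldr (ext T) ss W) (shifts U T P ss V W f)"

lemma msubst_derived_list:
  "msubst (derived_list U T P ss M) V W f =
   msubst M (foldr (ext T) ss V) (foldr (ext T) ss W) (shifts U T P ss V W f)"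
  unfolding derived_list_def by (induction ss arbitrary: M) (simp_all add: derived_def)

lemma lift_old:
  "lift (TSet U T) P W (ext T u W) (old T W) =
   subst P W (ext T u W) (fam_fun T W (\<lambda>t y. unit P (ext T u W) t (var_code (Some y))))"
  unfolding lift_def Comp_TSet_fam_fun
  by (rule arg_cong[where f = "subst P W (ext T u W)"], rule fam_fun_cong) (simp add: old_def)

lemma shift_fam_fun:
  assumes "set_universe (U :: 'u set set)"
  shows "shift U T P u V W f = fam_fun T (ext T u V) (\<lambda>t z. case inv var_code (z :: 'u) of
      None \<Rightarrow> unit P (ext T u W) u (var_code None)
    | Some x \<Rightarrow> subst P W (ext T u W)
        (fam_fun T W (\<lambda>t y. unit P (ext T u W) t (var_code (Some y)))) t (f t x))"
proof -
  have inv: "inv var_code (var_code (x :: 'u option)) = x" for x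
    using inj_var_code[OF set_universe_infinite[OF assms]] by simp
  show ?thesis
    unfolding shift_def copair_def lift_old fam_fun_def[of T "ext T u V"]
    by (intro restrict_ext)
      (auto simp: ext_mem_iff inv Comp_TSet_fam_fun)
qed

lemma msubst_arity_dom:
  assumes "set_universe U"
    and "list_all2 (\<lambda>x (ss, t). x \<in> ob R (foldr (ext T) ss V) t) xs (fst \<alpha>)"
  shows "msubst (arity_dom U T R \<alpha>) V W f (list_code xs) =
    list_code (map2 (\<lambda>(ss, t) x. subst R (foldr (ext T) ss V) (foldr (ext T) ss W)
      (shifts U T R ss V W f) t x) (fst \<alpha>) xs)"
proof -
  have "xs \<in> listset (map (\<lambda>(ss, t). ob R (foldr (ext T) ss V) t) (fst \<alpha>))"
    using assms(2) by (simp add: listset_map_iff split_def)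
  from prod_map_list_code[OF assms(1) this, of "\<lambda>(ss, t). subst R (foldr (ext T) ss V)
      (foldr (ext T) ss W) (shifts U T R ss V W f) t"]
  show ?thesis
    unfolding arity_dom_def arity_args_def
    by (simp add: prod_module_def comp_def fibre_def mob_derived_list msubst_derived_list
        tautological_def split_def)
qed

text \<open>Elements of the product are codes of argument lists, so the module law can be stated on
  lists. It is read in both directions: to establish the actions on terms and to exploit those of an
  arbitrary representation.\<close>

lemma module_hom_arity_iff:
  assumes U: "set_universe U" and R: "is_monad (TSet U T) R" and \<alpha>: "is_arity T \<alpha>"
  defines "args V xs \<equiv> list_all2 (\<lambda>x (ss, t). x \<in> ob R (foldr (ext T) ss V) t) xs (fst \<alpha>)"
  shows "\<rho> \<in> module_hom (TSet U T) R (Set_cat U) (arity_dom U T R \<alpha>) (arity_cod R \<alpha>) \<longleftrightarrow>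
    \<rho> \<in> extensional (Obj (TSet U T)) \<and>
    (\<forall>V\<in>Obj (TSet U T). \<rho> V \<in> extensional (mob (arity_dom U T R \<alpha>) V) \<and>
      (\<forall>xs. args V xs \<longrightarrow> \<rho> V (list_code xs) \<in> ob R V (snd \<alpha>)) \<and>
      (\<forall>W\<in>Obj (TSet U T). \<forall>f\<in>Hom (TSet U T) V (ob R W). \<forall>xs. args V xs \<longrightarrow>
        subst R V W f (snd \<alpha>) (\<rho> V (list_code xs)) =
        \<rho> W (list_code (map2 (\<lambda>(ss, t) x. subst R (foldr (ext T) ss V) (foldr (ext T) ss W)
          (shifts U T R ss V W f) t x) (fst \<alpha>) xs))))"
proof -
  have dom: "z \<in> mob (arity_dom U T R \<alpha>) V \<longleftrightarrow> (\<exists>xs. z = list_code xs \<and> args V xs)" for z V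
    unfolding mob_arity_dom prod_set_def args_def image_iff
    by (auto simp: listset_map_iff split_def)
  have hom: "\<rho> V \<in> Hom (Set_cat U) (mob (arity_dom U T R \<alpha>) V) (mob (arity_cod R \<alpha>) V) \<longleftrightarrow>
      \<rho> V \<in> extensional (mob (arity_dom U T R \<alpha>) V) \<and>
      (\<forall>xs. args V xs \<longrightarrow> \<rho> V (list_code xs) \<in> ob R V (snd \<alpha>))" for V
    by (auto simp: Set_cat_def PiE_def Pi_def dom mob_arity_cod)
  have "Comp (Set_cat U) (mob (arity_dom U T R \<alpha>) V) (mob (arity_cod R \<alpha>) V)
          (mob (arity_cod R \<alpha>) W) (\<rho> V) (msubst (arity_cod R \<alpha>) V W f) =
        Comp (Set_cat U) (mob (arity_dom U T R \<alpha>) V) (mob (arity_dom U T R \<alpha>) W)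
          (mob (arity_cod R \<alpha>) W) (msubst (arity_dom U T R \<alpha>) V W f) (\<rho> W) \<longleftrightarrow>
      (\<forall>xs. args V xs \<longrightarrow>
        subst R V W f (snd \<alpha>) (\<rho> V (list_code xs)) =
        \<rho> W (list_code (map2 (\<lambda>(ss, t) x. subst R (foldr (ext T) ss V) (foldr (ext T) ss W)
          (shifts U T R ss V W f) t x) (fst \<alpha>) xs)))" for V W f
  proof -
    have msubst: "msubst (arity_dom U T R \<alpha>) V W f (list_code xs) =
        list_code (map2 (\<lambda>(ss, t) x. subst R (foldr (ext T) ss V) (foldr (ext T) ss W)
          (shifts U T R ss V W f) t x) (fst \<alpha>) xs)" if "args V xs" for xs
      using that unfolding args_def by (rule msubst_arity_dom[OF U])
    have ball: "(\<forall>z\<in>mob (arity_dom U T R \<alpha>) V. p z) \<longleftrightarrow> (\<forall>xs. args V xs \<longrightarrow> p (list_code xs))" for p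
      unfolding Ball_def dom by auto
    show ?thesis
      unfolding Set_cat_def cat.simps compose_eq_iff ball
      by (simp add: msubst arity_cod_def fibre_def tautological_def cong: imp_cong)
  qed
  then show ?thesis
    unfolding module_hom_def mem_Collect_eq PiE_iff hom by (auto simp: eq_commute)
qed

section \<open>Terms with renaming and substitution\<close>

datatype ('i, 'u) tm = Var 'u | Op 'i "('i, 'u) tm list"

definition lift_ren :: "('t \<Rightarrow> 'u \<Rightarrow> 'u) \<Rightarrow> 't \<Rightarrow> 'u \<Rightarrow> 'u" where
  "lift_ren \<rho> t z = var_code (map_option (\<rho> t) (inv var_code z))"

text \<open>
  Lifting does not record the type of the fresh variable, so terms need not be annotated with
  types, and the fusion laws below hold for ill-typed terms as well.
\<close>

locale terms =
  fixes S :: "'i \<Rightarrow> 't arity" and var_type :: "'u itself"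
  assumes inf: "infinite (UNIV :: 'u set)"
begin

lemma inv_var_code [simp]: "inv var_code (var_code (x :: 'u option)) = x"
  using inj_var_code[OF inf] by simp

lemma var_code_eq [simp]: "var_code x = var_code y \<longleftrightarrow> x = (y :: 'u option)"
  using inj_var_code[OF inf] by (simp add: inj_eq)

text \<open>Each argument is renamed by its own lifting, so the recursive results must be functions
  of the renaming; \<open>ren_Op\<close> restores the direct form. Variables carry no type, hence
  the type of the term is passed along, and the arity supplies it for arguments.\<close>

primrec ren :: "('i, 'u) tm \<Rightarrow> ('t \<Rightarrow> 'u \<Rightarrow> 'u) \<Rightarrow> 't \<Rightarrow> ('i, 'u) tm" where
  "ren (Var x) = (\<lambda>\<rho> t. Var (\<rho> t x))"
| "ren (Op i as) = (\<lambda>\<rho> t. Op i (map2 (\<lambda>(ss, u) r. r ((lift_ren ^^ length ss) \<rho>) u)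
     (fst (S i)) (map ren as)))"

definition lift_sub :: "('t \<Rightarrow> 'u \<Rightarrow> ('i, 'u) tm) \<Rightarrow> 't \<Rightarrow> 'u \<Rightarrow> ('i, 'u) tm" where
  "lift_sub \<sigma> t z = (case inv var_code z of
     None \<Rightarrow> Var (var_code None)
   | Some x \<Rightarrow> ren (\<sigma> t x) (\<lambda>t y. var_code (Some y)) t)"

primrec sub :: "('i, 'u) tm \<Rightarrow> ('t \<Rightarrow> 'u \<Rightarrow> ('i, 'u) tm) \<Rightarrow> 't \<Rightarrow> ('i, 'u) tm" where
  "sub (Var x) = (\<lambda>\<sigma> t. \<sigma> t x)"
| "sub (Op i as) = (\<lambda>\<sigma> t. Op i (map2 (\<lambda>(ss, u) r. r ((lift_sub ^^ length ss) \<sigma>) u)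
     (fst (S i)) (map sub as)))"

lemma ren_Op [simp]:
  "ren (Op i as) \<rho> t = Op i (map2 (\<lambda>(ss, u) a. ren a ((lift_ren ^^ length ss) \<rho>) u) (fst (S i)) as)"
  by (simp add: zip_map2 split_def)

lemma sub_Op [simp]:
  "sub (Op i as) \<sigma> t = Op i (map2 (\<lambda>(ss, u) a. sub a ((lift_sub ^^ length ss) \<sigma>) u) (fst (S i)) as)"
  by (simp add: zip_map2 split_def)

declare ren.simps(2) [simp del] sub.simps(2) [simp del]

section \<open>Fusion laws for renaming and substitution\<close>

lemma lift_ren_comp:
  fixes \<rho> \<rho>' :: "'t \<Rightarrow> 'u \<Rightarrow> 'u"
  shows "lift_ren (\<lambda>t x. \<rho>' t (\<rho> t x)) = (\<lambda>t z. lift_ren \<rho>' t (lift_ren \<rho> t z))"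
  by (simp add: lift_ren_def fun_eq_iff option.map_comp comp_def)

lemma lift_rens_comp:
  fixes \<rho> \<rho>' :: "'t \<Rightarrow> 'u \<Rightarrow> 'u"
  shows "(lift_ren ^^ n) (\<lambda>t x. \<rho>' t (\<rho> t x)) = (\<lambda>t z. (lift_ren ^^ n) \<rho>' t ((lift_ren ^^ n) \<rho> t z))"
  by (induction n) (simp_all add: lift_ren_comp)

lemma ren_ren: "ren (ren a \<rho> t) \<rho>' t = ren a (\<lambda>t x. \<rho>' t (\<rho> t x)) t"
  by (induction a arbitrary: \<rho> \<rho>' t)
    (auto simp: map_zip_map_zip split_def lift_rens_comp simp del: map_eq_conv intro!: map_zip_cong)

lemma lift_subs_ren:
  "(lift_sub ^^ n) (\<lambda>t x. \<tau> t (\<rho> t x)) = (\<lambda>t z. (lift_sub ^^ n) \<tau> t ((lift_ren ^^ n) \<rho> t z))"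
proof (induction n)
  case (Suc n)
  have "lift_sub (\<lambda>t x. \<tau> t (\<rho> t x)) = (\<lambda>t z. lift_sub \<tau> t (lift_ren \<rho> t z))" for \<tau> \<rho>
    by (auto simp: lift_sub_def lift_ren_def fun_eq_iff split: option.split)
  with Suc show ?case by simp
qed simp

lemma sub_ren: "sub (ren a \<rho> t) \<tau> t = sub a (\<lambda>t x. \<tau> t (\<rho> t x)) t"
  by (induction a arbitrary: \<rho> \<tau> t)
    (auto simp: map_zip_map_zip split_def lift_subs_ren simp del: map_eq_conv intro!: map_zip_cong)

lemma ren_lift_subs:
  "(lift_sub ^^ n) (\<lambda>t x. ren (\<sigma> t x) \<rho> t) = (\<lambda>t z. ren ((lift_sub ^^ n) \<sigma> t z) ((lift_ren ^^ n) \<rho>) t)"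
proof (induction n)
  case (Suc n)
  have "lift_sub (\<lambda>t x. ren (\<sigma> t x) \<rho> t) = (\<lambda>t z. ren (lift_sub \<sigma> t z) (lift_ren \<rho>) t)" for \<sigma> \<rho>
    by (auto simp: lift_sub_def lift_ren_def ren_ren fun_eq_iff split: option.split)
  with Suc show ?case by simp
qed simp

lemma ren_sub: "ren (sub a \<sigma> t) \<rho> t = sub a (\<lambda>t x. ren (\<sigma> t x) \<rho> t) t"
  by (induction a arbitrary: \<rho> \<sigma> t)
    (auto simp: map_zip_map_zip split_def ren_lift_subs simp del: map_eq_conv intro!: map_zip_cong)

text \<open>At an old variable one side weakens after substituting and the other substitutes after
  weakening; \<open>ren_sub\<close> and \<open>sub_ren\<close> bring both to the substitution by the
  weakened \<open>\<tau>\<close>.\<close>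

lemma sub_lift_subs:
  "(lift_sub ^^ n) (\<lambda>t x. sub (\<sigma> t x) \<tau> t) = (\<lambda>t z. sub ((lift_sub ^^ n) \<sigma> t z) ((lift_sub ^^ n) \<tau>) t)"
proof (induction n)
  case (Suc n)
  have "lift_sub (\<lambda>t x. sub (\<sigma> t x) \<tau> t) = (\<lambda>t z. sub (lift_sub \<sigma> t z) (lift_sub \<tau>) t)" for \<sigma> \<tau>
    by (auto simp: lift_sub_def ren_sub sub_ren fun_eq_iff split: option.split)
  with Suc show ?case by simp
qed simp

lemma sub_sub: "sub (sub a \<sigma> t) \<tau> t = sub a (\<lambda>t x. sub (\<sigma> t x) \<tau> t) t"
  by (induction a arbitrary: \<sigma> \<tau> t)
    (auto simp: map_zip_map_zip split_def sub_lift_subs simp del: map_eq_conv intro!: map_zip_cong)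

lemma lift_sub_Var: "lift_sub (\<lambda>t x. Var (\<rho> t x)) = (\<lambda>t z. Var (lift_ren \<rho> t z))"
  by (auto simp: lift_sub_def lift_ren_def fun_eq_iff split: option.split)

text \<open>Renaming has to be defined before substitution, whose lifting uses it. Once both exist,
  weakening can be treated as a substitution by variables, as in \<open>shift_Syn\<close> and
  \<open>ini_ren\<close>.\<close>

lemma ren_eq_sub: "ren a \<rho> t = sub a (\<lambda>t x. Var (\<rho> t x)) t"
proof -
  have lifts: "(lift_sub ^^ n) (\<lambda>t x. Var (\<rho> t x)) = (\<lambda>t z. Var ((lift_ren ^^ n) \<rho> t z))" for n \<rho>
    by (induction n) (simp_all add: lift_sub_Var)
  show ?thesis
    by (induction a arbitrary: \<rho> t) (auto simp: split_def lifts simp del: map_eq_conv intro!: map_zip_cong)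
qed

end

section \<open>Well-typed terms\<close>

locale binding_signature =
  fixes U :: "'u set set" and T :: "'t set" and I :: "'i set" and S :: "'i \<Rightarrow> 't arity"
  assumes U: "set_universe U" and S: "signature U T I S"

sublocale binding_signature \<subseteq> terms S "TYPE('u)"
  by unfold_locales (rule set_universe_infinite[OF U])

context binding_signature
begin

abbreviation exts :: "'t list \<Rightarrow> ('t, 'u) fam \<Rightarrow> ('t, 'u) fam" where
  "exts ss V \<equiv> foldr (ext T) ss V"

lemma arity: "i \<in> I \<Longrightarrow> is_arity T (S i)"
  using S by (simp add: signature_def)

lemma arg_in_T: "\<lbrakk>i \<in> I; (ss, t) \<in> set (fst (S i))\<rbrakk> \<Longrightarrow> t \<in> T"
  and binder_in_T: "\<lbrakk>i \<in> I; (ss, t) \<in> set (fst (S i))\<rbrakk> \<Longrightarrow> set ss \<subseteq> T"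
  and cod_in_T: "i \<in> I \<Longrightarrow> snd (S i) \<in> T"
  using arity[of i] by (force simp: is_arity_def lists_eq_set)+

text \<open>\<open>list_all2\<close> also fixes the number of arguments, so the truncation in
  \<open>map2\<close> loses nothing on well-typed terms.\<close>

primrec wt :: "('i, 'u) tm \<Rightarrow> ('t, 'u) fam \<Rightarrow> 't \<Rightarrow> bool" where
  "wt (Var x) = (\<lambda>V t. x \<in> V t)"
| "wt (Op i as) = (\<lambda>V t. i \<in> I \<and> snd (S i) = t \<and>
     list_all2 (\<lambda>w (ss, u). w (exts ss V) u) (map wt as) (fst (S i)))"

lemma wt_Op [simp]:
  "wt (Op i as) V t \<longleftrightarrow> i \<in> I \<and> snd (S i) = t \<and>
    list_all2 (\<lambda>a (ss, u). wt a (exts ss V) u) as (fst (S i))"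
  by (simp add: list_all2_map1)

declare wt.simps(2) [simp del]

section \<open>Traversal of arguments and preservation of typing\<close>

lemma exts_mono_lift:
  assumes "\<And>u V W \<sigma> \<sigma>'. R V W \<sigma> \<sigma>' \<Longrightarrow> R (ext T u V) (ext T u W) (L \<sigma>) (L' \<sigma>')" and "R V W \<sigma> \<sigma>'"
  shows "R (exts ss V) (exts ss W) ((L ^^ length ss) \<sigma>) ((L' ^^ length ss) \<sigma>')"
  using assms(2) by (induction ss) (simp_all add: assms(1))

text \<open>The assumption on \<open>F\<close> concerns only members of \<open>as\<close>, with
  types from \<open>T\<close> and in their own extended context: exactly the situations in which an
  induction hypothesis on terms is available.\<close>

lemma list_all2_map2_wt:
  assumes "wt (Op i as) V t"
    and "\<And>a ss u. \<lbrakk>a \<in> set as; u \<in> T; set ss \<subseteq> T; wt a (exts ss V) u\<rbrakk> \<Longrightarrow> R ss u (F ss u a)"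
  shows "list_all2 (\<lambda>y (ss, u). R ss u y) (map2 (\<lambda>(ss, u) a. F ss u a) (fst (S i)) as) (fst (S i))"
proof (rule list_all2_map2I)
  have i: "i \<in> I" using assms(1) by simp
  show "list_all2 (\<lambda>a (ss, u). wt a (exts ss V) u) as (fst (S i))" using assms(1) by simp
  fix p a assume "p \<in> set (fst (S i))" "a \<in> set as" "case p of (ss, u) \<Rightarrow> wt a (exts ss V) u"
  then show "case p of (ss, u) \<Rightarrow> R ss u ((case p of (ss, u) \<Rightarrow> F ss u) a)"
    using assms(2)[of a "snd p" "fst p"] arg_in_T[OF i, of "fst p" "snd p"]
      binder_in_T[OF i, of "fst p" "snd p"] by (simp add: split_def)
qed

lemma wt_map2:
  assumes "wt (Op i as) V t"
    and "\<And>a ss u. \<lbrakk>a \<in> set as; u \<in> T; set ss \<subseteq> T; wt a (exts ss V) u\<rbrakk> \<Longrightarrow> wt (F ss u a) (exts ss W) u"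
  shows "wt (Op i (map2 (\<lambda>(ss, u) a. F ss u a) (fst (S i)) as)) W t"
  using list_all2_map2_wt[OF assms(1), of "\<lambda>ss u a. wt a (exts ss W) u" F] assms by simp

lemma map2_cong_wt:
  assumes "wt (Op i as) V t"
    and "\<And>a ss u. \<lbrakk>a \<in> set as; u \<in> T; set ss \<subseteq> T; wt a (exts ss V) u\<rbrakk> \<Longrightarrow> F ss u a = G ss u a"
  shows "map2 (\<lambda>(ss, u) a. F ss u a) (fst (S i)) as = map2 (\<lambda>(ss, u) a. G ss u a) (fst (S i)) as"
proof (rule map2_cong_list_all2)
  have i: "i \<in> I" using assms(1) by simp
  show "list_all2 (\<lambda>a (ss, u). wt a (exts ss V) u) as (fst (S i))" using assms(1) by simp
  fix p a assume "p \<in> set (fst (S i))" "a \<in> set as" "case p of (ss, u) \<Rightarrow> wt a (exts ss V) u"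
  then show "(case p of (ss, u) \<Rightarrow> F ss u) a = (case p of (ss, u) \<Rightarrow> G ss u) a"
    using assms(2)[of a "snd p" "fst p"] arg_in_T[OF i, of "fst p" "snd p"]
      binder_in_T[OF i, of "fst p" "snd p"] by (simp add: split_def)
qed

lemma map2_snd_wt: "wt (Op i as) V t \<Longrightarrow> map2 (\<lambda>(ss, u) a. F a) (fst (S i)) as = map F as"
  by (rule map2_eq_map[where P = "\<lambda>a (ss, u). wt a (exts ss V) u"]) auto

lemma wt_ren:
  "\<lbrakk>wt a V t; t \<in> T; \<And>t x. \<lbrakk>t \<in> T; x \<in> V t\<rbrakk> \<Longrightarrow> \<rho> t x \<in> W t\<rbrakk> \<Longrightarrow> wt (ren a \<rho> t) W t"
proof (induction a arbitrary: V W \<rho> t)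
  case (Op i as)
  have lifts: "\<forall>t\<in>T. \<forall>x\<in>exts ss V t. (lift_ren ^^ length ss) \<rho> t x \<in> exts ss W t" for ss
    by (rule exts_mono_lift[where R = "\<lambda>V W \<rho> _. \<forall>t\<in>T. \<forall>x\<in>V t. \<rho> t x \<in> W t"])
      (use Op.prems(3) in \<open>fastforce simp: ext_mem_iff lift_ren_def\<close>)+
  show ?case
    unfolding ren_Op
  proof (rule wt_map2[OF Op.prems(1)])
    fix a ss u
    assume "a \<in> set as" "u \<in> T" "wt a (exts ss V) u"
    then show "wt (ren a ((lift_ren ^^ length ss) \<rho>) u) (exts ss W) u"
      using lifts by (intro Op.IH[where V = "exts ss V"]) auto
  qed
qed simp

definition sub_typed :: "('t, 'u) fam \<Rightarrow> ('t, 'u) fam \<Rightarrow> ('t \<Rightarrow> 'u \<Rightarrow> ('i, 'u) tm) \<Rightarrow> bool" where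
  "sub_typed V W \<sigma> \<longleftrightarrow> (\<forall>t\<in>T. \<forall>x\<in>V t. wt (\<sigma> t x) W t)"

lemma sub_typed_lift:
  assumes "sub_typed V W \<sigma>"
  shows "sub_typed (ext T u V) (ext T u W) (lift_sub \<sigma>)"
proof -
  have "wt (ren (\<sigma> t x) (\<lambda>t y. var_code (Some y)) t) (ext T u W) t" if "t \<in> T" "x \<in> V t" for t x
    by (rule wt_ren[where V = W]) (use assms that in \<open>auto simp: sub_typed_def ext_mem_iff\<close>)
  then show ?thesis
    by (auto simp: sub_typed_def ext_mem_iff lift_sub_def)
qed

lemma sub_typed_lifts:
  "sub_typed V W \<sigma> \<Longrightarrow> sub_typed (exts ss V) (exts ss W) ((lift_sub ^^ length ss) \<sigma>)"
  by (induction ss) (simp_all add: sub_typed_lift)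

lemma wt_sub: "\<lbrakk>wt a V t; t \<in> T; sub_typed V W \<sigma>\<rbrakk> \<Longrightarrow> wt (sub a \<sigma> t) W t"
proof (induction a arbitrary: V W \<sigma> t)
  case (Op i as)
  show ?case
    unfolding sub_Op
  proof (rule wt_map2[OF Op.prems(1)])
    fix a ss u
    assume "a \<in> set as" "u \<in> T" "wt a (exts ss V) u"
    then show "wt (sub a ((lift_sub ^^ length ss) \<sigma>) u) (exts ss W) u"
      by (intro Op.IH[where V = "exts ss V"] sub_typed_lifts Op.prems(3))
  qed
qed (simp add: sub_typed_def)

text \<open>\<open>subst_Syn\<close> needs this because decoding \<open>encs V \<sigma>\<close>
  recovers \<open>\<sigma>\<close> only on the members of \<open>V\<close>.\<close>

lemma sub_cong:
  "\<lbrakk>wt a V t; t \<in> T; \<And>t x. \<lbrakk>t \<in> T; x \<in> V t\<rbrakk> \<Longrightarrow> \<sigma> t x = \<sigma>' t x\<rbrakk> \<Longrightarrow> sub a \<sigma> t = sub a \<sigma>' t"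
proof (induction a arbitrary: V \<sigma> \<sigma>' t)
  case (Op i as)
  have lifts: "\<forall>t\<in>T. \<forall>x\<in>exts ss V t. (lift_sub ^^ length ss) \<sigma> t x = (lift_sub ^^ length ss) \<sigma>' t x" for ss
    by (rule exts_mono_lift[where R = "\<lambda>V _ \<sigma> \<sigma>'. \<forall>t\<in>T. \<forall>x\<in>V t. \<sigma> t x = \<sigma>' t x"])
      (use Op.prems(3) in \<open>auto simp: ext_mem_iff lift_sub_def\<close>)
  have "map2 (\<lambda>(ss, u) a. sub a ((lift_sub ^^ length ss) \<sigma>) u) (fst (S i)) as =
      map2 (\<lambda>(ss, u) a. sub a ((lift_sub ^^ length ss) \<sigma>') u) (fst (S i)) as"
  proof (rule map2_cong_wt[OF Op.prems(1)])
    fix a ss u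
    assume "a \<in> set as" "u \<in> T" "wt a (exts ss V) u"
    then show "sub a ((lift_sub ^^ length ss) \<sigma>) u = sub a ((lift_sub ^^ length ss) \<sigma>') u"
      using lifts by (intro Op.IH[where V = "exts ss V"]) auto
  qed
  then show ?case by simp
qed simp

text \<open>Outside the range of \<open>var_code\<close> a lifting of \<open>Var\<close> need not be
  \<open>Var\<close> again, so the unit law is stated for substitutions that agree with
  \<open>Var\<close> on the context.\<close>

lemma sub_Var:
  "\<lbrakk>wt a V t; t \<in> T; \<And>t x. \<lbrakk>t \<in> T; x \<in> V t\<rbrakk> \<Longrightarrow> \<sigma> t x = Var x\<rbrakk> \<Longrightarrow> sub a \<sigma> t = a"
proof (induction a arbitrary: V \<sigma> t)
  case (Op i as)
  have lifts: "\<forall>t\<in>T. \<forall>x\<in>exts ss V t. (lift_sub ^^ length ss) \<sigma> t x = Var x" for ss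
    by (rule exts_mono_lift[where R = "\<lambda>V _ \<sigma> _. \<forall>t\<in>T. \<forall>x\<in>V t. \<sigma> t x = Var x"])
      (use Op.prems(3) in \<open>auto simp: ext_mem_iff lift_sub_def\<close>)
  have "map2 (\<lambda>(ss, u) a. sub a ((lift_sub ^^ length ss) \<sigma>) u) (fst (S i)) as =
      map2 (\<lambda>(ss, u) a. a) (fst (S i)) as"
  proof (rule map2_cong_wt[OF Op.prems(1)])
    fix a ss u
    assume "a \<in> set as" "u \<in> T" "wt a (exts ss V) u"
    then show "sub a ((lift_sub ^^ length ss) \<sigma>) u = a"
      using lifts by (intro Op.IH[where V = "exts ss V"]) auto
  qed
  also have "\<dots> = as"
    using map2_snd_wt[OF Op.prems(1), of "\<lambda>a. a"] by simp
  finally show ?case by simp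
qed simp

section \<open>Coding terms in the universe\<close>

definition op_code :: "'i \<Rightarrow> 'u" where
  "op_code = (SOME e. inj_on e I)"

lemma inj_op_code: "inj_on op_code I"
proof -
  obtain B and e :: "'i \<Rightarrow> 'u" where "bij_betw e I B"
    using S by (auto simp: signature_def small_def eqpoll_def)
  then show ?thesis
    unfolding op_code_def by (metis bij_betw_def someI_ex)
qed

text \<open>The repeated \<open>op_code i\<close> makes codes of compound terms longer than those of variables.\<close>

primrec enc :: "('i, 'u) tm \<Rightarrow> 'u" where
  "enc (Var x) = list_code [x]"
| "enc (Op i as) = list_code (op_code i # op_code i # map enc as)"

lemma list_code_eq [simp]: "list_code xs = list_code ys \<longleftrightarrow> xs = (ys :: 'u list)"
  using inj_list_code[OF inf] by (simp add: inj_eq)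

lemma wt_arg: "\<lbrakk>wt (Op i as) V t; a \<in> set as\<rbrakk> \<Longrightarrow> \<exists>V t. wt a V t"
  using list_all2_memD[of "\<lambda>a (ss, u). wt a (exts ss V) u" as "fst (S i)" a]
  by (auto simp: split_def)

text \<open>Typing is assumed because \<open>op_code\<close> is injective only on \<open>I\<close>.
  The two contexts and types may differ, so one decoder \<open>dec\<close> works for all of
  them.\<close>

lemma enc_inj: "\<lbrakk>wt a V t; wt b W u; enc a = enc b\<rbrakk> \<Longrightarrow> a = b"
proof (induction a arbitrary: V t b W u)
  case (Var x)
  then show ?case by (cases b) simp_all
next
  case (Op i as)
  then obtain j bs where b: "b = Op j bs" by (cases b) simp_all
  have "i = j" and enc: "map enc as = map enc bs"
    using Op.prems inj_op_code by (auto simp: b dest: inj_onD)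
  have "as ! k = bs ! k" if k: "k < length as" for k
  proof -
    have k': "k < length bs" using k enc by (metis length_map)
    have "\<exists>V t. wt (as ! k) V t" and "\<exists>V t. wt (bs ! k) V t"
      using Op.prems(1,2) nth_mem[OF k] nth_mem[OF k'] b wt_arg by blast+
    moreover have "enc (as ! k) = enc (bs ! k)" using enc k k' by (metis nth_map)
    ultimately show ?thesis using Op.IH[OF nth_mem[OF k]] by blast
  qed
  moreover have "length as = length bs" using enc by (metis length_map)
  ultimately show ?case by (simp add: b \<open>i = j\<close> nth_equalityI)
qed

definition dec :: "'u \<Rightarrow> ('i, 'u) tm" where
  "dec = inv_into {a. \<exists>V t. wt a V t} enc"

lemma dec_enc: "wt a V t \<Longrightarrow> dec (enc a) = a"
  unfolding dec_def by (rule inv_into_f_f) (auto intro!: inj_onI dest: enc_inj)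

section \<open>Sets of coded terms belong to the universe\<close>

lemma small_UN:
  assumes "small U A" and "\<And>a. a \<in> A \<Longrightarrow> F a \<in> U"
  shows "(\<Union>a\<in>A. F a) \<in> U"
proof -
  obtain B g where B: "B \<in> U" "bij_betw g B A"
    using assms(1) by (metis small_def eqpoll_def eqpoll_sym)
  then have "(\<Union>a\<in>A. F a) = (\<Union>b\<in>B. F (g b))" by (auto simp: bij_betw_def)
  also have "\<dots> \<in> U"
    using B assms(2) by (intro set_universeD(3)[OF U]) (auto simp: bij_betw_def)
  finally show ?thesis .
qed

lemma small_nat: "small U (UNIV :: nat set)"
proof -
  obtain A where A: "A \<in> U" "infinite A" using set_universeD(4)[OF U] by blast
  then obtain f :: "nat \<Rightarrow> 'u" where f: "inj f" "range f \<subseteq> A"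
    using infinite_countable_subset by blast
  have "range f \<in> U" using set_universeD(1)[OF U A(1) f(2)] .
  then show ?thesis
    using inj_on_image_eqpoll_self[OF f(1)] eqpoll_sym unfolding small_def by blast
qed

definition tms :: "('t, 'u) fam \<Rightarrow> ('t, 'u) fam" where
  "tms V = (\<lambda>t\<in>T. enc ` {a. wt a V t})"

lemma mem_tms_iff: "t \<in> T \<Longrightarrow> z \<in> tms V t \<longleftrightarrow> (\<exists>a. z = enc a \<and> wt a V t)"
  by (auto simp: tms_def)

lemma enc_in_tms: "\<lbrakk>t \<in> T; wt a V t\<rbrakk> \<Longrightarrow> enc a \<in> tms V t"
  by (auto simp: tms_def)

text \<open>A term in the next stage is a variable or an operation whose arguments lie in the
  current stage over extended contexts. Since \<open>U\<close> is closed under subsets, it is enough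
  to cover the codes; \<open>V\<close> and \<open>t\<close> vary in the induction because binders
  change them.\<close>

lemma bounded_terms_in_U:
  "\<lbrakk>V \<in> Obj (TSet U T); t \<in> T\<rbrakk> \<Longrightarrow> enc ` {a. wt a V t \<and> size a < n} \<in> U"
proof (induction n arbitrary: V t)
  case 0
  then show ?case by (simp add: set_universe_finite[OF U])
next
  case (Suc n)
  let ?args = "\<lambda>i. map (\<lambda>(ss, u). enc ` {a. wt a (exts ss V) u \<and> size a < n}) (fst (S i))"
  \<comment> \<open>Members of the product are coded lists; they are unpacked so that the two
    leading operation codes required by \<open>enc\<close> can be put in front.\<close>
  let ?ops = "\<lambda>i. (\<lambda>z. list_code (op_code i # op_code i # inv list_code z)) ` prod_set (?args i)"
  have "enc a \<in> (\<lambda>x. list_code [x]) ` V t \<union> (\<Union>i\<in>I. ?ops i)" if a: "wt a V t" "size a < Suc n" for a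
  proof (cases a)
    case (Op i as)
    have "size b < n" if "b \<in> set as" for b
      using a(2) that size_list_estimation'[of b as "size b" size] by (simp add: Op)
    moreover have "list_all2 (\<lambda>a p. wt a (exts (fst p) V) (snd p)) as (fst (S i))"
      using a(1) by (simp add: Op split_def)
    ultimately have "list_all2 (\<lambda>a p. enc a \<in> enc ` {a. wt a (exts (fst p) V) (snd p) \<and> size a < n})
        as (fst (S i))"
      by (auto intro: list.rel_mono_strong)
    then have "list_code (map enc as) \<in> prod_set (?args i)"
      by (simp add: prod_set_def listset_map_iff list_all2_map1 split_def)
    then have "enc a \<in> ?ops i"
      by (rule rev_image_eqI) (simp add: Op inv_list_code[OF U])
    moreover have "i \<in> I" using a(1) by (simp add: Op)
    ultimately show ?thesis by blast
  next
    case (Var x)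
    then show ?thesis using a(1) by simp
  qed
  then have "enc ` {a. wt a V t \<and> size a < Suc n} \<subseteq>
      (\<lambda>x. list_code [x]) ` V t \<union> (\<Union>i\<in>I. ?ops i)" by blast
  moreover have "(\<lambda>x. list_code [x]) ` V t \<in> U"
    by (rule set_universeD(2)[OF U Obj_TSet_apply[OF Suc.prems]])
  moreover have "(\<Union>i\<in>I. ?ops i) \<in> U"
  proof (rule small_UN)
    fix i assume i: "i \<in> I"
    show "?ops i \<in> U"
    proof (intro set_universeD(2)[OF U] prod_set_in_universe[OF U])
      fix A assume "A \<in> set (?args i)"
      then obtain ss u where "(ss, u) \<in> set (fst (S i))"
        and "A = enc ` {a. wt a (exts ss V) u \<and> size a < n}" by auto
      then show "A \<in> U"
        using Suc.IH[OF exts_in_Obj[OF U Suc.prems(1)] arg_in_T[OF i]] by blast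
    qed
  qed (use S in \<open>simp add: signature_def\<close>)
  ultimately show ?case
    by (meson set_universeD(1)[OF U] set_universe_Un[OF U])
qed

lemma tms_in_Obj:
  assumes "V \<in> Obj (TSet U T)"
  shows "tms V \<in> Obj (TSet U T)"
  unfolding tms_def Obj_TSet restrict_PiE_iff
proof
  fix t assume t: "t \<in> T"
  have "enc ` {a. wt a V t} = (\<Union>n. enc ` {a. wt a V t \<and> size a < n})"
    by blast
  also have "\<dots> \<in> U"
    by (intro small_UN small_nat bounded_terms_in_U assms t)
  finally show "enc ` {a. wt a V t} \<in> U" .
qed

section \<open>The representation on terms\<close>

definition encs :: "('t, 'u) fam \<Rightarrow> ('t \<Rightarrow> 'u \<Rightarrow> ('i, 'u) tm) \<Rightarrow> ('t, 'u) fam_map" where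
  "encs V \<sigma> = fam_fun T V (\<lambda>t x. enc (\<sigma> t x))"

lemma encs_apply [simp]: "\<lbrakk>t \<in> T; x \<in> V t\<rbrakk> \<Longrightarrow> encs V \<sigma> t x = enc (\<sigma> t x)"
  by (simp add: encs_def)

lemma encs_in_Hom: "sub_typed V W \<sigma> \<Longrightarrow> encs V \<sigma> \<in> Hom (TSet U T) V (tms W)"
  unfolding encs_def fam_fun_in_Hom by (auto simp: mem_tms_iff sub_typed_def)

text \<open>Every morphism into coded terms comes from a typed substitution, so the monad and module
  laws can be checked on substitutions instead of codes.\<close>

lemma Hom_tmsE:
  assumes "f \<in> Hom (TSet U T) V (tms W)"
  obtains \<sigma> where "sub_typed V W \<sigma>" and "f = encs V \<sigma>"
proof
  have *: "\<exists>a. f t x = enc a \<and> wt a W t" if "t \<in> T" "x \<in> V t" for t x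
    using Hom_TSet_apply[OF assms that] that by (simp add: mem_tms_iff)
  show "sub_typed V W (\<lambda>t x. dec (f t x))"
    unfolding sub_typed_def using * by (metis dec_enc)
  have "encs V (\<lambda>t x. dec (f t x)) = fam_fun T V f"
    unfolding encs_def by (rule fam_fun_cong) (metis * dec_enc)
  then show "f = encs V (\<lambda>t x. dec (f t x))"
    by (simp add: fam_fun_eta[OF assms])
qed

text \<open>The \<open>prod_set\<close> is the domain of the arity written out by
  \<open>mob_arity_dom\<close>, as \<open>Syn\<close> is still being defined. Both restrictions in
  \<open>act\<close> provide the extensionality that \<open>module_hom\<close> demands.\<close>

definition Syn :: "('t, 'u, 'i) representation" where
  "Syn = \<lparr>ob = tms,
     unit = (\<lambda>V. encs V (\<lambda>t x. Var x)),
     subst = (\<lambda>V W f. fam_fun T (tms V) (\<lambda>t z. enc (sub (dec z) (\<lambda>t x. dec (f t x)) t))),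
     act = (\<lambda>i. \<lambda>V\<in>Obj (TSet U T).
       \<lambda>z\<in>prod_set (map (\<lambda>(ss, t). tms (exts ss V) t) (fst (S i))). enc (Op i (map dec (inv list_code z))))\<rparr>"

lemma ob_Syn [simp]: "ob Syn = tms"
  and unit_Syn [simp]: "unit Syn V = encs V (\<lambda>t x. Var x)"
  by (simp_all add: Syn_def)

lemma subst_Syn:
  assumes "sub_typed V W \<sigma>"
  shows "subst Syn V W (encs V \<sigma>) = fam_fun T (tms V) (\<lambda>t z. enc (sub (dec z) \<sigma> t))"
  unfolding Syn_def kmonad.simps
proof (rule fam_fun_cong)
  fix t z assume t: "t \<in> T" and "z \<in> tms V t"
  then obtain a where a: "z = enc a" "wt a V t" by (auto simp: mem_tms_iff)
  have "sub a (\<lambda>t x. dec (encs V \<sigma> t x)) t = sub a \<sigma> t"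
    using assms by (intro sub_cong[OF a(2) t]) (auto simp: sub_typed_def intro!: dec_enc)
  then show "enc (sub (dec z) (\<lambda>t x. dec (encs V \<sigma> t x)) t) = enc (sub (dec z) \<sigma> t)"
    by (simp add: a(1) dec_enc[OF a(2)])
qed

lemma subst_Syn_enc:
  "\<lbrakk>sub_typed V W \<sigma>; t \<in> T; wt a V t\<rbrakk> \<Longrightarrow> subst Syn V W (encs V \<sigma>) t (enc a) = enc (sub a \<sigma> t)"
  by (simp add: subst_Syn enc_in_tms dec_enc[of a V t])

lemma sub_typed_Var: "sub_typed V V (\<lambda>t x. Var x)"
  by (simp add: sub_typed_def)

lemma is_monad_Syn: "is_monad (TSet U T) Syn"
  unfolding is_monad_def
proof (intro conjI ballI)
  fix V assume "V \<in> Obj (TSet U T)"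
  then show "ob Syn V \<in> Obj (TSet U T)" by (simp add: tms_in_Obj)
  show "unit Syn V \<in> Hom (TSet U T) V (ob Syn V)"
    by (simp add: encs_in_Hom sub_typed_Var)
  show "subst Syn V V (unit Syn V) = Ident (TSet U T) (ob Syn V)"
    unfolding unit_Syn subst_Syn[OF sub_typed_Var] Ident_TSet_fam_fun ob_Syn
    by (rule fam_fun_cong) (auto simp: mem_tms_iff dec_enc sub_Var)
  fix W f assume "f \<in> Hom (TSet U T) V (ob Syn W)"
  then obtain \<sigma> where \<sigma>: "sub_typed V W \<sigma>" and f: "f = encs V \<sigma>" by (auto elim: Hom_tmsE)
  show "subst Syn V W f \<in> Hom (TSet U T) (ob Syn V) (ob Syn W)"
    unfolding f subst_Syn[OF \<sigma>] ob_Syn fam_fun_in_Hom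
    using \<sigma> by (auto simp: mem_tms_iff[of _ _ V] dec_enc intro!: enc_in_tms wt_sub)
  show "Comp (TSet U T) V (ob Syn V) (ob Syn W) (unit Syn V) (subst Syn V W f) = f"
    unfolding Comp_TSet_fam_fun f encs_def[of V \<sigma>]
    by (rule fam_fun_cong) (simp add: subst_Syn_enc[OF \<sigma>] del: enc.simps flip: encs_def)
  fix X g assume "g \<in> Hom (TSet U T) W (ob Syn X)"
  then obtain \<tau> where \<tau>: "sub_typed W X \<tau>" and g: "g = encs W \<tau>" by (auto elim: Hom_tmsE)
  \<comment> \<open>The Kleisli composite is again a coded substitution, so associativity becomes
    \<open>sub_sub\<close>.\<close>
  have "Comp (TSet U T) V (ob Syn W) (ob Syn X) f (subst Syn W X g) =
      encs V (\<lambda>t x. sub (\<sigma> t x) \<tau> t)"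
    unfolding Comp_TSet_fam_fun f g encs_def[of V "\<lambda>t x. sub (\<sigma> t x) \<tau> t"]
    using \<sigma> by (intro fam_fun_cong) (simp add: subst_Syn_enc[OF \<tau>] sub_typed_def)
  moreover have "sub_typed V X (\<lambda>t x. sub (\<sigma> t x) \<tau> t)"
    using \<sigma> \<tau> by (auto simp: sub_typed_def[of V] intro: wt_sub)
  ultimately have eq: "subst Syn V X (Comp (TSet U T) V (ob Syn W) (ob Syn X) f (subst Syn W X g)) =
      fam_fun T (tms V) (\<lambda>t z. enc (sub (dec z) (\<lambda>t x. sub (\<sigma> t x) \<tau> t) t))"
    by (simp add: subst_Syn)
  have "subst Syn W X g t (subst Syn V W f t z) = enc (sub (dec z) (\<lambda>t x. sub (\<sigma> t x) \<tau> t) t)"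
    if t: "t \<in> T" and "z \<in> tms V t" for t z
  proof -
    obtain a where a: "z = enc a" "wt a V t" using \<open>z \<in> tms V t\<close> t by (auto simp: mem_tms_iff)
    show ?thesis
      by (simp add: f g a(1) subst_Syn_enc[OF \<sigma> t a(2)] subst_Syn_enc[OF \<tau> t wt_sub[OF a(2) t \<sigma>]]
          sub_sub dec_enc[OF a(2)])
  qed
  then show "Comp (TSet U T) (ob Syn V) (ob Syn W) (ob Syn X) (subst Syn V W f) (subst Syn W X g) =
      subst Syn V X (Comp (TSet U T) V (ob Syn W) (ob Syn X) f (subst Syn W X g))"
    unfolding eq unfolding Comp_TSet_fam_fun ob_Syn by (rule fam_fun_cong)
qed

text \<open>On an old variable \<open>shift\<close> substitutes weakened variables into
  \<open>\<sigma> t x\<close>, which is a renaming by \<open>ren_eq_sub\<close>. Thus substitution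
  in the derived modules of terms follows the binder clause of \<open>sub\<close>.\<close>

lemma shift_Syn:
  assumes \<sigma>: "sub_typed V W \<sigma>"
  shows "shift U T Syn u V W (encs V \<sigma>) = encs (ext T u V) (lift_sub \<sigma>)"
proof -
  let ?ren = "\<lambda>t y. Var (var_code (Some y)) :: ('i, 'u) tm"
  have weaken: "sub_typed W (ext T u W) ?ren"
    by (simp add: sub_typed_def ext_mem_iff)
  have "fam_fun T W (\<lambda>t y. unit Syn (ext T u W) t (var_code (Some y))) = encs W ?ren"
    unfolding encs_def[of W] by (rule fam_fun_cong) (simp add: ext_mem_iff)
  then show ?thesis
    unfolding shift_fam_fun[OF U] encs_def[of "ext T u V"]
    using \<sigma> by (intro fam_fun_cong)
      (auto simp: ext_mem_iff lift_sub_def sub_typed_def subst_Syn_enc[OF weaken] ren_eq_sub)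
qed

lemma shifts_Syn:
  "sub_typed V W \<sigma> \<Longrightarrow> shifts U T Syn ss V W (encs V \<sigma>) = encs (exts ss V) ((lift_sub ^^ length ss) \<sigma>)"
  by (induction ss) (simp_all add: shift_Syn sub_typed_lifts)

section \<open>The operations as module morphisms\<close>

lemma args_Syn_iff:
  assumes "i \<in> I"
  shows "list_all2 (\<lambda>x (ss, t). x \<in> tms (exts ss V) t) xs (fst (S i)) \<longleftrightarrow>
    (\<exists>as. xs = map enc as \<and> wt (Op i as) V (snd (S i)))" (is "?L \<longleftrightarrow> ?R")
proof
  assume L: ?L
  have dec: "enc (dec x) = x" "wt (dec x) (exts ss V) t"
    if "x \<in> tms (exts ss V) t" "(ss, t) \<in> set (fst (S i))" for x ss t
    using that arg_in_T[OF assms that(2)] by (auto simp: mem_tms_iff dec_enc)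
  have "enc (dec x) = x" if x: "x \<in> set xs" for x
  proof -
    obtain ss t where "(ss, t) \<in> set (fst (S i))" "x \<in> tms (exts ss V) t"
      using list_all2_memD[OF L x] by auto
    then show ?thesis using dec(1) by blast
  qed
  then have "map enc (map dec xs) = xs" by (simp add: map_idI)
  moreover have "list_all2 (\<lambda>x (ss, t). wt (dec x) (exts ss V) t) xs (fst (S i))"
    by (rule list.rel_mono_strong[OF L]) (use dec(2) in auto)
  ultimately show ?R
    using assms by (intro exI[of _ "map dec xs"]) (simp add: list_all2_map1)
next
  assume ?R
  then obtain as where as: "xs = map enc as" "wt (Op i as) V (snd (S i))" by blast
  then have "list_all2 (\<lambda>a (ss, u). wt a (exts ss V) u) as (fst (S i))" by simp
  then show ?L
    unfolding as(1) list_all2_map1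
    by (rule list.rel_mono_strong) (use arg_in_T[OF assms] in \<open>auto simp: mem_tms_iff\<close>)
qed

lemma mob_dom_Syn:
  assumes "i \<in> I"
  shows "mob (arity_dom U T Syn (S i)) V = {list_code (map enc as) |as. wt (Op i as) V (snd (S i))}"
proof -
  have "z \<in> mob (arity_dom U T Syn (S i)) V \<longleftrightarrow>
      (\<exists>xs. z = list_code xs \<and> list_all2 (\<lambda>x (ss, t). x \<in> tms (exts ss V) t) xs (fst (S i)))" for z
    unfolding mob_arity_dom prod_set_def image_iff by (auto simp: listset_map_iff split_def)
  then show ?thesis unfolding args_Syn_iff[OF assms] by auto
qed

lemma map_dec_enc:
  assumes "wt (Op i as) V t"
  shows "map dec (map enc as) = as"
proof -
  have "dec (enc a) = a" if "a \<in> set as" for a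
    using wt_arg[OF assms that] dec_enc by blast
  then show ?thesis by (simp add: map_idI)
qed

lemma act_Syn:
  assumes "V \<in> Obj (TSet U T)" and "wt (Op i as) V t"
  shows "act Syn i V (list_code (map enc as)) = enc (Op i as)"
proof -
  have "list_code (map enc as) \<in> mob (arity_dom U T Syn (S i)) V"
    using assms(2) mob_dom_Syn[of i V] by auto
  then show ?thesis
    using map_dec_enc[OF assms(2)] assms(1)
    by (simp add: Syn_def mob_arity_dom inv_list_code[OF U] del: enc.simps map_map)
qed

lemma is_representation_Syn: "is_representation U T I S Syn"
  unfolding is_representation_def
proof (intro conjI ballI is_monad_Syn)
  fix i assume i: "i \<in> I"
  show "act Syn i \<in> module_hom (TSet U T) Syn (Set_cat U) (arity_dom U T Syn (S i)) (arity_cod Syn (S i))"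
    unfolding module_hom_arity_iff[OF U is_monad_Syn arity[OF i]] ob_Syn args_Syn_iff[OF i]
  proof (intro conjI ballI allI impI)
    show "act Syn i \<in> extensional (Obj (TSet U T))" by (simp add: Syn_def)
    fix V assume V: "V \<in> Obj (TSet U T)"
    then show "act Syn i V \<in> extensional (mob (arity_dom U T Syn (S i)) V)"
      by (simp add: Syn_def mob_arity_dom)
    fix xs assume "\<exists>as. xs = map enc as \<and> wt (Op i as) V (snd (S i))"
    then obtain as where xs: "xs = map enc as" and as: "wt (Op i as) V (snd (S i))" by blast
    show "act Syn i V (list_code xs) \<in> tms V (snd (S i))"
      unfolding xs act_Syn[OF V as] using as unfolding mem_tms_iff[OF cod_in_T[OF i]] by blast
    fix W f assume W: "W \<in> Obj (TSet U T)" and "f \<in> Hom (TSet U T) V (tms W)"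
    then obtain \<sigma> where \<sigma>: "sub_typed V W \<sigma>" and f: "f = encs V \<sigma>" by (auto elim: Hom_tmsE)
    let ?bs = "map2 (\<lambda>(ss, u) a. sub a ((lift_sub ^^ length ss) \<sigma>) u) (fst (S i)) as"
    \<comment> \<open>By \<open>shifts_Syn\<close> the module substitution on the arguments is what
      \<open>sub_Op\<close> performs, so the module law for the action is the clause of
      \<open>sub\<close> for operations.\<close>
    have "map2 (\<lambda>(ss, u) x. subst Syn (exts ss V) (exts ss W) (shifts U T Syn ss V W f) u x) (fst (S i)) xs
        = map2 (\<lambda>(ss, u) a. subst Syn (exts ss V) (exts ss W) (shifts U T Syn ss V W f) u (enc a)) (fst (S i)) as"
      by (simp add: xs zip_map2 split_def comp_def)
    also have "\<dots> = map2 (\<lambda>(ss, u) a. enc (sub a ((lift_sub ^^ length ss) \<sigma>) u)) (fst (S i)) as"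
      by (rule map2_cong_wt[OF as]) (simp add: f shifts_Syn[OF \<sigma>] subst_Syn_enc[OF sub_typed_lifts[OF \<sigma>]])
    also have "\<dots> = map enc ?bs"
      by (simp add: split_def comp_def)
    finally have eq: "map2 (\<lambda>(ss, u) x. subst Syn (exts ss V) (exts ss W) (shifts U T Syn ss V W f) u x)
        (fst (S i)) xs = map enc ?bs" .
    have "wt (Op i ?bs) W (snd (S i))"
      using wt_sub[OF as cod_in_T[OF i] \<sigma>] by simp
    then have "act Syn i W (list_code (map enc ?bs)) = enc (Op i ?bs)"
      by (rule act_Syn[OF W])
    also have "\<dots> = subst Syn V W f (snd (S i)) (act Syn i V (list_code xs))"
      unfolding xs act_Syn[OF V as] f by (simp only: subst_Syn_enc[OF \<sigma> cod_in_T[OF i] as] sub_Op)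
    finally show "subst Syn V W f (snd (S i)) (act Syn i V (list_code xs)) =
        act Syn i W (list_code (map2 (\<lambda>(ss, t) x. subst Syn (exts ss V) (exts ss W)
          (shifts U T Syn ss V W f) t x) (fst (S i)) xs))"
      unfolding eq ..
  qed
qed

text \<open>On coded terms the square is the recursion equation for operations. It serves existence,
  where \<open>ini\<close> satisfies it by definition, and uniqueness, where it drives the
  induction.\<close>

lemma representation_square_iff:
  assumes i: "i \<in> I" and V: "V \<in> Obj (TSet U T)"
  shows "Comp (Set_cat U) (mob (arity_dom U T Syn (S i)) V) (mob (arity_cod Syn (S i)) V)
        (mob (arity_cod Q (S i)) V) (act Syn i V) (g V (snd (S i))) =
      Comp (Set_cat U) (mob (arity_dom U T Syn (S i)) V) (mob (arity_dom U T Q (S i)) V)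
        (mob (arity_cod Q (S i)) V) (arity_mor U T Syn (S i) g V) (act Q i V) \<longleftrightarrow>
    (\<forall>as. wt (Op i as) V (snd (S i)) \<longrightarrow> g V (snd (S i)) (enc (Op i as)) =
      act Q i V (list_code (map2 (\<lambda>(ss, u) a. g (exts ss V) u (enc a)) (fst (S i)) as)))"
proof -
  have mor: "arity_mor U T Syn (S i) g V (list_code (map enc as)) =
      list_code (map2 (\<lambda>(ss, u) a. g (exts ss V) u (enc a)) (fst (S i)) as)"
    if as: "wt (Op i as) V (snd (S i))" for as
  proof -
    have "list_all2 (\<lambda>x (ss, t). x \<in> tms (exts ss V) t) (map enc as) (fst (S i))"
      unfolding args_Syn_iff[OF i] using as by blast
    then have "map enc as \<in> listset (map (\<lambda>(ss, t). tms (exts ss V) t) (fst (S i)))"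
      by (simp add: listset_map_iff split_def)
    from prod_map_list_code[OF U this, of "\<lambda>(ss, u). g (exts ss V) u"] show ?thesis
      unfolding arity_mor_apply[OF U V] ob_Syn by (simp add: zip_map2 split_def comp_def)
  qed
  have ball: "(\<forall>z\<in>mob (arity_dom U T Syn (S i)) V. p z) \<longleftrightarrow>
      (\<forall>as. wt (Op i as) V (snd (S i)) \<longrightarrow> p (list_code (map enc as)))" for p
    unfolding mob_dom_Syn[OF i] by blast
  show ?thesis
    unfolding Set_cat_def cat.simps compose_eq_iff ball
    by (simp add: mor act_Syn[OF V] del: enc.simps wt_Op cong: imp_cong)
qed

section \<open>Initiality\<close>

context
  fixes Q :: "('t, 'u, 'i) representation"
  assumes Q: "is_representation U T I S Q"
begin

private lemmas monad = is_representationD(1)[OF Q]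

text \<open>The context is an argument of the recursion because both \<open>unit\<close> and
  \<open>act\<close> depend on it and arguments are interpreted in extended contexts.\<close>

primrec ini :: "('i, 'u) tm \<Rightarrow> ('t, 'u) fam \<Rightarrow> 't \<Rightarrow> 'u" where
  "ini (Var x) = (\<lambda>V t. unit Q V t x)"
| "ini (Op i as) = (\<lambda>V t. act Q i V (list_code
     (map2 (\<lambda>(ss, u) r. r (exts ss V) u) (fst (S i)) (map ini as))))"

lemma ini_Op [simp]:
  "ini (Op i as) V t =
    act Q i V (list_code (map2 (\<lambda>(ss, u) a. ini a (exts ss V) u) (fst (S i)) as))"
  by (simp add: zip_map2 split_def comp_def)

declare ini.simps(2) [simp del]

lemma unit_in_ob: "\<lbrakk>V \<in> Obj (TSet U T); t \<in> T; x \<in> V t\<rbrakk> \<Longrightarrow> unit Q V t x \<in> ob Q V t"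
  by (rule Hom_TSet_apply[OF is_monadD(2)[OF monad]])

lemma subst_unit:
  assumes "V \<in> Obj (TSet U T)" "W \<in> Obj (TSet U T)" "f \<in> Hom (TSet U T) V (ob Q W)" "t \<in> T" "x \<in> V t"
  shows "subst Q V W f t (unit Q V t x) = f t x"
proof -
  have "fam_fun T V (\<lambda>t x. subst Q V W f t (unit Q V t x)) t x = f t x"
    using is_monadD(4)[OF monad assms(1-3)] unfolding Comp_TSet_fam_fun by (rule fun_cong[OF fun_cong])
  then show ?thesis using assms(4,5) by simp
qed

lemma
  assumes i: "i \<in> I" and V: "V \<in> Obj (TSet U T)"
    and xs: "list_all2 (\<lambda>x (ss, t). x \<in> ob Q (exts ss V) t) xs (fst (S i))"
  shows act_in_ob: "act Q i V (list_code xs) \<in> ob Q V (snd (S i))"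
    and subst_act: "\<lbrakk>W \<in> Obj (TSet U T); f \<in> Hom (TSet U T) V (ob Q W)\<rbrakk> \<Longrightarrow>
      subst Q V W f (snd (S i)) (act Q i V (list_code xs)) =
      act Q i W (list_code (map2 (\<lambda>(ss, t) x. subst Q (exts ss V) (exts ss W)
        (shifts U T Q ss V W f) t x) (fst (S i)) xs))"
proof -
  have "act Q i \<in> module_hom (TSet U T) Q (Set_cat U) (arity_dom U T Q (S i)) (arity_cod Q (S i))"
    using Q i by (simp add: is_representation_def)
  note act = this[unfolded module_hom_arity_iff[OF U monad arity[OF i]], THEN conjunct2, rule_format, OF V]
  show "act Q i V (list_code xs) \<in> ob Q V (snd (S i))"
    using act xs by blast
  show "subst Q V W f (snd (S i)) (act Q i V (list_code xs)) =
      act Q i W (list_code (map2 (\<lambda>(ss, t) x. subst Q (exts ss V) (exts ss W)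
        (shifts U T Q ss V W f) t x) (fst (S i)) xs))"
    if "W \<in> Obj (TSet U T)" "f \<in> Hom (TSet U T) V (ob Q W)"
    using act xs that by blast
qed

lemma ini_in_ob: "\<lbrakk>wt a V t; V \<in> Obj (TSet U T); t \<in> T\<rbrakk> \<Longrightarrow> ini a V t \<in> ob Q V t"
proof (induction a arbitrary: V t)
  case (Var x)
  then show ?case by (simp add: unit_in_ob)
next
  case (Op i as)
  have "list_all2 (\<lambda>x (ss, u). x \<in> ob Q (exts ss V) u)
      (map2 (\<lambda>(ss, u) a. ini a (exts ss V) u) (fst (S i)) as) (fst (S i))"
    by (rule list_all2_map2_wt[OF Op.prems(1)]) (intro Op.IH exts_in_Obj[OF U] Op.prems(2))
  then show ?case
    using act_in_ob[OF _ Op.prems(2)] Op.prems(1) by auto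
qed

section \<open>The interpretation commutes with substitution\<close>

abbreviation inis where
  "inis V W \<sigma> \<equiv> fam_fun T V (\<lambda>t x. ini (\<sigma> t x) W t)"

lemma inis_in_Hom:
  "\<lbrakk>sub_typed V W \<sigma>; W \<in> Obj (TSet U T)\<rbrakk> \<Longrightarrow> inis V W \<sigma> \<in> Hom (TSet U T) V (ob Q W)"
  unfolding fam_fun_in_Hom sub_typed_def by (simp add: ini_in_ob)

text \<open>
  \<open>K\<close> is instantiated first to renamings, for which \<open>shift\<close> is easy to compute, and then, using the
  result for the renaming that weakens a term, to all well-typed substitutions.
\<close>

lemma ini_sub_if:
  assumes typed: "\<And>V W \<sigma>. K V W \<sigma> \<Longrightarrow> sub_typed V W \<sigma>"
    and lift: "\<And>u V W \<sigma>. \<lbrakk>K V W \<sigma>; u \<in> T; V \<in> Obj (TSet U T); W \<in> Obj (TSet U T)\<rbrakk> \<Longrightarrow>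
      K (ext T u V) (ext T u W) (lift_sub \<sigma>)"
    and shift: "\<And>u V W \<sigma>. \<lbrakk>K V W \<sigma>; u \<in> T; V \<in> Obj (TSet U T); W \<in> Obj (TSet U T)\<rbrakk> \<Longrightarrow>
      shift U T Q u V W (inis V W \<sigma>) = inis (ext T u V) (ext T u W) (lift_sub \<sigma>)"
  shows "\<lbrakk>wt a V t; t \<in> T; V \<in> Obj (TSet U T); W \<in> Obj (TSet U T); K V W \<sigma>\<rbrakk> \<Longrightarrow>
    ini (sub a \<sigma> t) W t = subst Q V W (inis V W \<sigma>) t (ini a V t)"
proof (induction a arbitrary: V W \<sigma> t)
  case (Var x)
  then show ?case by (simp add: subst_unit[OF _ _ inis_in_Hom[OF typed]])
next
  case (Op i as)
  note V = Op.prems(3) and W = Op.prems(4) and K = Op.prems(5)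
  have i: "i \<in> I" and t: "t = snd (S i)" using Op.prems(1) by simp_all
  \<comment> \<open>The two parts are proved together: \<open>shift\<close> applies to the next
    binder only if \<open>K\<close> already holds for the lifted substitution.\<close>
  have lifts: "K (exts ss V) (exts ss W) ((lift_sub ^^ length ss) \<sigma>) \<and>
      shifts U T Q ss V W (inis V W \<sigma>) = inis (exts ss V) (exts ss W) ((lift_sub ^^ length ss) \<sigma>)"
    if "set ss \<subseteq> T" for ss
    using that by (induction ss) (simp_all add: K lift shift exts_in_Obj[OF U] V W)
  have xs: "list_all2 (\<lambda>x (ss, u). x \<in> ob Q (exts ss V) u)
      (map2 (\<lambda>(ss, u) a. ini a (exts ss V) u) (fst (S i)) as) (fst (S i))"
    by (rule list_all2_map2_wt[OF Op.prems(1)]) (intro ini_in_ob exts_in_Obj[OF U] V)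
  have "ini (sub (Op i as) \<sigma> t) W t = act Q i W (list_code (map2
      (\<lambda>(ss, u) a. ini (sub a ((lift_sub ^^ length ss) \<sigma>) u) (exts ss W) u) (fst (S i)) as))"
    by (simp add: map_zip_map_zip split_def)
  also have "map2 (\<lambda>(ss, u) a. ini (sub a ((lift_sub ^^ length ss) \<sigma>) u) (exts ss W) u) (fst (S i)) as =
      map2 (\<lambda>(ss, u) a. subst Q (exts ss V) (exts ss W) (shifts U T Q ss V W (inis V W \<sigma>)) u
        (ini a (exts ss V) u)) (fst (S i)) as"
    by (rule map2_cong_wt[OF Op.prems(1)]) (simp add: Op.IH lifts exts_in_Obj[OF U] V W)
  \<comment> \<open>The action of \<open>Q\<close> is a module morphism, so by
    \<open>subst_act\<close> the substitutions on the arguments move outside it.\<close>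
  also have "act Q i W (list_code \<dots>) = subst Q V W (inis V W \<sigma>) t (ini (Op i as) V t)"
    unfolding t ini_Op subst_act[OF i V xs W inis_in_Hom[OF typed[OF K] W]]
    by (simp add: map_zip_map_zip split_def)
  finally show ?case .
qed

lemma unit_weaken_in_Hom:
  "W \<in> Obj (TSet U T) \<Longrightarrow> fam_fun T W (\<lambda>t y. unit Q (ext T u W) t (var_code (Some y)))
    \<in> Hom (TSet U T) W (ob Q (ext T u W))"
  unfolding fam_fun_in_Hom by (simp add: unit_in_ob ext_in_Obj[OF U] ext_mem_iff)

lemma ini_ren:
  assumes "wt a V t" "t \<in> T" "V \<in> Obj (TSet U T)" "W \<in> Obj (TSet U T)"
    and "\<And>t x. \<lbrakk>t \<in> T; x \<in> V t\<rbrakk> \<Longrightarrow> \<rho> t x \<in> W t"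
  shows "ini (ren a \<rho> t) W t = subst Q V W (fam_fun T V (\<lambda>t x. unit Q W t (\<rho> t x))) t (ini a V t)"
proof -
  \<comment> \<open>Quantifying over the underlying \<open>\<rho>\<close> makes this class closed
    under lifting: by \<open>lift_sub_Var\<close> the lifted substitution is given by
    \<open>lift_ren \<rho>\<close>.\<close>
  let ?K = "\<lambda>(V :: ('t, 'u) fam) (W :: ('t, 'u) fam) (\<sigma> :: 't \<Rightarrow> 'u \<Rightarrow> ('i, 'u) tm).
    \<exists>\<rho>. \<sigma> = (\<lambda>t x. Var (\<rho> t x)) \<and> (\<forall>t\<in>T. \<forall>x\<in>V t. \<rho> t x \<in> W t)"
  have "ini (sub a (\<lambda>t x. Var (\<rho> t x)) t) W t = subst Q V W (inis V W (\<lambda>t x. Var (\<rho> t x))) t (ini a V t)"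
  proof (rule ini_sub_if[where K = ?K])
    fix u V W \<sigma>
    assume "?K V W \<sigma>"
    then obtain \<rho> where \<sigma>: "\<sigma> = (\<lambda>t x. Var (\<rho> t x))" and \<rho>: "\<forall>t\<in>T. \<forall>x\<in>V t. \<rho> t x \<in> W t"
      by blast
    show "sub_typed V W \<sigma>" using \<rho> by (simp add: sub_typed_def \<sigma>)
    show "?K (ext T u V) (ext T u W) (lift_sub \<sigma>)"
      unfolding \<sigma> lift_sub_Var using \<rho>
      by (intro exI[of _ "lift_ren \<rho>"]) (fastforce simp: ext_mem_iff lift_ren_def)
    assume "V \<in> Obj (TSet U T)" and W: "W \<in> Obj (TSet U T)"
    show "shift U T Q u V W (inis V W \<sigma>) = inis (ext T u V) (ext T u W) (lift_sub \<sigma>)"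
      unfolding shift_fam_fun[OF U] \<sigma> lift_sub_Var
    proof (rule fam_fun_cong)
      fix t z assume t: "t \<in> T" and "z \<in> ext T u V t"
      then consider "z = var_code None" "t = u" | x where "x \<in> V t" "z = var_code (Some x)"
        by (auto simp: ext_mem_iff)
      \<comment> \<open>A renaming sends every variable to a variable, interpreted as a unit of
        \<open>Q\<close>; the left unit law then evaluates the weakening, and no statement about
        weakened terms is needed.\<close>
      then show "(case inv var_code z of None \<Rightarrow> unit Q (ext T u W) u (var_code None)
          | Some x \<Rightarrow> subst Q W (ext T u W) (fam_fun T W (\<lambda>t y. unit Q (ext T u W) t (var_code (Some y)))) t
              (inis V W (\<lambda>t x. Var (\<rho> t x)) t x)) = ini (Var (lift_ren \<rho> t z)) (ext T u W) t"
        using t \<rho> by cases (simp_all add: lift_ren_def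
            subst_unit[OF W ext_in_Obj[OF U W] unit_weaken_in_Hom[OF W]])
    qed
  next
    show "?K V W (\<lambda>t x. Var (\<rho> t x))" using assms(5) by blast
  qed (fact assms)+
  then show ?thesis by (simp add: ren_eq_sub)
qed

lemma ini_sub:
  assumes "wt a V t" "t \<in> T" "V \<in> Obj (TSet U T)" "W \<in> Obj (TSet U T)" "sub_typed V W \<sigma>"
  shows "ini (sub a \<sigma> t) W t = subst Q V W (inis V W \<sigma>) t (ini a V t)"
proof (rule ini_sub_if[where K = sub_typed])
  fix u V W \<sigma>
  assume \<sigma>: "sub_typed V W \<sigma>"
  show "sub_typed V W \<sigma>" by (rule \<sigma>)
  show "sub_typed (ext T u V) (ext T u W) (lift_sub \<sigma>)" by (rule sub_typed_lift[OF \<sigma>])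
  assume "V \<in> Obj (TSet U T)" and W: "W \<in> Obj (TSet U T)"
  show "shift U T Q u V W (inis V W \<sigma>) = inis (ext T u V) (ext T u W) (lift_sub \<sigma>)"
    unfolding shift_fam_fun[OF U]
  proof (rule fam_fun_cong)
    fix t z assume t: "t \<in> T" and "z \<in> ext T u V t"
    then consider "z = var_code None" "t = u" | x where "x \<in> V t" "z = var_code (Some x)"
      by (auto simp: ext_mem_iff)
    then show "(case inv var_code z of None \<Rightarrow> unit Q (ext T u W) u (var_code None)
        | Some x \<Rightarrow> subst Q W (ext T u W) (fam_fun T W (\<lambda>t y. unit Q (ext T u W) t (var_code (Some y)))) t
            (inis V W \<sigma> t x)) = ini (lift_sub \<sigma> t z) (ext T u W) t"
    proof cases
      case (2 x)
      have "wt (\<sigma> t x) W t" using \<sigma> t 2(1) by (simp add: sub_typed_def)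
      from ini_ren[OF this t W ext_in_Obj[OF U W], of "\<lambda>_ y. var_code (Some y)" u]
      show ?thesis using t 2 by (simp add: lift_sub_def ext_mem_iff)
    qed (simp add: lift_sub_def)
  qed
qed (fact assms)+

section \<open>The initial morphism and its uniqueness\<close>

definition ini_hom :: "('t, 'u) fam \<Rightarrow> ('t, 'u) fam_map" where
  "ini_hom = (\<lambda>V\<in>Obj (TSet U T). fam_fun T (tms V) (\<lambda>t z. ini (dec z) V t))"

lemma ini_hom_enc:
  "\<lbrakk>V \<in> Obj (TSet U T); t \<in> T; wt a V t\<rbrakk> \<Longrightarrow> ini_hom V t (enc a) = ini a V t"
  by (simp add: ini_hom_def enc_in_tms dec_enc[of a V t])

lemma ini_hom_in_monad_hom: "ini_hom \<in> monad_hom (TSet U T) Syn Q"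
  unfolding monad_hom_def mem_Collect_eq
proof (intro conjI ballI)
  have "fam_fun T (tms V) (\<lambda>t z. ini (dec z) V t) \<in> Hom (TSet U T) (tms V) (ob Q V)"
    if "V \<in> Obj (TSet U T)" for V
    unfolding fam_fun_in_Hom using that by (auto simp: mem_tms_iff dec_enc ini_in_ob)
  then show "ini_hom \<in> (\<Pi>\<^sub>E V\<in>Obj (TSet U T). Hom (TSet U T) (ob Syn V) (ob Q V))"
    unfolding ini_hom_def restrict_PiE_iff by simp
  fix V assume V: "V \<in> Obj (TSet U T)"
  have "Comp (TSet U T) V (ob Syn V) (ob Q V) (unit Syn V) (ini_hom V) = fam_fun T V (unit Q V)"
    unfolding Comp_TSet_fam_fun
    by (rule fam_fun_cong) (simp add: ini_hom_enc[OF V] del: enc.simps)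
  then show "Comp (TSet U T) V (ob Syn V) (ob Q V) (unit Syn V) (ini_hom V) = unit Q V"
    by (simp add: fam_fun_eta[OF is_monadD(2)[OF monad V]])
  fix W f assume W: "W \<in> Obj (TSet U T)" and "f \<in> Hom (TSet U T) V (ob Syn W)"
  then obtain \<sigma> where \<sigma>: "sub_typed V W \<sigma>" and f: "f = encs V \<sigma>" by (auto elim: Hom_tmsE)
  have eq: "Comp (TSet U T) V (ob Syn W) (ob Q W) f (ini_hom W) = inis V W \<sigma>"
    unfolding Comp_TSet_fam_fun f using \<sigma>
    by (intro fam_fun_cong) (simp add: ini_hom_enc[OF W] sub_typed_def)
  have "ini_hom W t (subst Syn V W f t z) = subst Q V W (inis V W \<sigma>) t (ini_hom V t z)"
    if t: "t \<in> T" and "z \<in> tms V t" for t z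
  proof -
    obtain a where a: "z = enc a" "wt a V t" using \<open>z \<in> tms V t\<close> t by (auto simp: mem_tms_iff)
    show ?thesis
      unfolding a(1) f subst_Syn_enc[OF \<sigma> t a(2)] ini_hom_enc[OF V t a(2)]
        ini_hom_enc[OF W t wt_sub[OF a(2) t \<sigma>]]
      by (rule ini_sub[OF a(2) t V W \<sigma>])
  qed
  then show "Comp (TSet U T) (ob Syn V) (ob Syn W) (ob Q W) (subst Syn V W f) (ini_hom W) =
      Comp (TSet U T) (ob Syn V) (ob Q V) (ob Q W) (ini_hom V)
        (subst Q V W (Comp (TSet U T) V (ob Syn W) (ob Q W) f (ini_hom W)))"
    unfolding eq unfolding Comp_TSet_fam_fun ob_Syn by (rule fam_fun_cong)
qed

lemma ini_hom_in_representation_hom: "ini_hom \<in> representation_hom U T I S Syn Q"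
  unfolding representation_hom_iff
proof (intro conjI ballI ini_hom_in_monad_hom)
  fix i V assume i: "i \<in> I" and V: "V \<in> Obj (TSet U T)"
  have "ini_hom V (snd (S i)) (enc (Op i as)) =
      act Q i V (list_code (map2 (\<lambda>(ss, u) a. ini_hom (exts ss V) u (enc a)) (fst (S i)) as))"
    if as: "wt (Op i as) V (snd (S i))" for as
  proof -
    have "map2 (\<lambda>(ss, u) a. ini_hom (exts ss V) u (enc a)) (fst (S i)) as =
        map2 (\<lambda>(ss, u) a. ini a (exts ss V) u) (fst (S i)) as"
      by (rule map2_cong_wt[OF as]) (simp add: ini_hom_enc exts_in_Obj[OF U V])
    then show ?thesis
      unfolding ini_hom_enc[OF V cod_in_T[OF i] as] ini_Op by (simp only:)
  qed
  then show "Comp (Set_cat U) (mob (arity_dom U T Syn (S i)) V) (mob (arity_cod Syn (S i)) V)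
        (mob (arity_cod Q (S i)) V) (act Syn i V) (ini_hom V (snd (S i))) =
      Comp (Set_cat U) (mob (arity_dom U T Syn (S i)) V) (mob (arity_dom U T Q (S i)) V)
        (mob (arity_cod Q (S i)) V) (arity_mor U T Syn (S i) ini_hom V) (act Q i V)"
    unfolding representation_square_iff[OF i V] by blast
qed

text \<open>The unit law determines \<open>g\<close> on variables and the squares determine it on
  operations. All contexts are treated at once, since the square at \<open>V\<close> refers to
  \<open>g\<close> at the extensions of \<open>V\<close>.\<close>

lemma representation_hom_enc:
  assumes "g \<in> representation_hom U T I S Syn Q"
  shows "\<lbrakk>wt a V t; V \<in> Obj (TSet U T); t \<in> T\<rbrakk> \<Longrightarrow> g V t (enc a) = ini a V t"
proof (induction a arbitrary: V t)
  case (Var x)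
  have "g \<in> monad_hom (TSet U T) Syn Q"
    using assms by (simp add: representation_hom_iff)
  from monad_homD(3)[OF this Var.prems(2)]
  have "fam_fun T V (\<lambda>t x. g V t (unit Syn V t x)) t x = unit Q V t x"
    unfolding Comp_TSet_fam_fun by simp
  then show ?case using Var.prems by simp
next
  case (Op i as)
  have i: "i \<in> I" and t: "t = snd (S i)" using Op.prems(1) by simp_all
  have "g V t (enc (Op i as)) =
      act Q i V (list_code (map2 (\<lambda>(ss, u) a. g (exts ss V) u (enc a)) (fst (S i)) as))"
    using assms[unfolded representation_hom_iff, THEN conjunct2, rule_format, OF i Op.prems(2),
        unfolded representation_square_iff[OF i Op.prems(2)]] Op.prems(1)
    unfolding t by blast
  also have "map2 (\<lambda>(ss, u) a. g (exts ss V) u (enc a)) (fst (S i)) as =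
      map2 (\<lambda>(ss, u) a. ini a (exts ss V) u) (fst (S i)) as"
    by (rule map2_cong_wt[OF Op.prems(1)]) (intro Op.IH exts_in_Obj[OF U] Op.prems(2))
  finally show ?case by simp
qed

lemma representation_hom_unique:
  assumes g: "g \<in> representation_hom U T I S Syn Q"
  shows "g = ini_hom"
proof (rule extensionalityI)
  have g': "g \<in> monad_hom (TSet U T) Syn Q"
    using g by (simp add: representation_hom_iff)
  show "g \<in> extensional (Obj (TSet U T))" by (rule monad_homD(2)[OF g'])
  show "ini_hom \<in> extensional (Obj (TSet U T))" by (simp add: ini_hom_def)
  fix V assume V: "V \<in> Obj (TSet U T)"
  \<comment> \<open>Rewriting \<open>g V\<close> in extensional form reduces the claim to members of
    \<open>tms V\<close>, which are all codes of well-typed terms.\<close>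
  have "g V = fam_fun T (tms V) (g V)"
    using fam_fun_eta[OF monad_homD(1)[OF g' V]] by simp
  also have "\<dots> = fam_fun T (tms V) (\<lambda>t z. ini (dec z) V t)"
    by (rule fam_fun_cong) (auto simp: mem_tms_iff representation_hom_enc[OF g _ V] dec_enc)
  finally show "g V = ini_hom V" using V by (simp add: ini_hom_def)
qed

end

lemma initial_object_Syn: "initial_object (Rep U T I S) Syn"
  unfolding initial_object_def
proof (intro conjI ballI)
  show "Syn \<in> Obj (Rep U T I S)" by (simp add: Rep_def is_representation_Syn)
  fix Q assume "Q \<in> Obj (Rep U T I S)"
  then have Q: "is_representation U T I S Q" by (simp add: Rep_def)
  show "\<exists>!f. f \<in> Hom (Rep U T I S) Syn Q"
    by (rule ex1I[of _ "ini_hom Q"])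
      (simp_all add: Rep_def ini_hom_in_representation_hom[OF Q] representation_hom_unique[OF Q])
qed

end

theorem mainTheorem1:
  fixes U :: "'u set set" and T :: "'t set" and I :: "'i set" and S :: "'i \<Rightarrow> 't arity"
  assumes "set_universe U" and "small U T" and "signature U T I S"
  shows "\<exists>\<Sigma>. initial_object (Rep U T I S) \<Sigma>"
proof -
  interpret binding_signature U T I S
    using assms by unfold_locales
  show ?thesis using initial_object_Syn by blast
qed

end
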